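(* In the setting and with the notation of the context (frame-discretized nonlinear problem, $\mathbf{H}$, $r^*$, $L$, the procedure $\mathbf{FIXPT}$ with iterates $\vec{\mathbf v}_n$), assume that $$\|\vec{\mathbf l}\|_{\ell_2(\mathcal N)}<\bigl(4\,\|(\mathbf A_{|\operatorname{ran}\mathbf A})^{-1}\|^2\|F\|^3\|A_1\|\bigr)^{-1}$$ and that $\mathcal E_n\le r^*$ for all $n\in\mathbb N$, where $$\mathcal E_n:=\sum_{k=2}^{n+1}\varepsilon_k+(1+L)\sum_{h=0}^{n-3}\sum_{k=3}^{n-h}\varepsilon_kL^{n-h-k}+\Bigl(\varepsilon_1+L\bigl(\varepsilon_0+\|(\mathbf A_{|\operatorname{ran}\mathbf A})^{-1}\|\,\|\vec{\mathbf l}\|\bigr)\Bigr)\sum_{k=0}^{n-1}L^k+\varepsilon_0+\|(\mathbf A_{|\operatorname{ran}\mathbf A})^{-1}\|\,\|\vec{\mathbf l}\|.$$ Let $\vec{\mathbf u}\in \boldsymbol B_{r^*}$ be the fixed point of $\mathbf H$ in $\boldsymbol B_{r^*}$. Then: (1) $\mathbf H(\vec{\mathbf u})=\vec{\mathbf u}=\lim_{n\to\infty}\mathbf P\vec{\mathbf v}_n=\mathbf P\bigl(\mathbf{FIXPT}[0,\mathbf A,\mathbf A_1,\vec{\mathbf l}]\bigr)$, where the $\vec{\mathbf v}_n$ are the iterates produced by $\mathbf{FIXPT}$. (2) After $n$ iterations of $\mathbf{FIXPT}$ one gets $$\|\mathbf P\vec{\mathbf v}_{n+1}-\vec{\mathbf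 u}\|_{\ell_2(\mathcal N)}\le \varepsilon_0\,\frac{\varepsilon_0^n\bigl(\varepsilon_0-L(L/\varepsilon_0)^n\bigr)}{\varepsilon_0-L}+L^n\|\vec{\mathbf u}\|_{\ell_2(\mathcal N)}\le \varepsilon_0\,\frac{\varepsilon_0^n\bigl(\varepsilon_0-L(L/\varepsilon_0)^n\bigr)}{\varepsilon_0-L}+L^nr^*.$$ (3) Therefore, for $\varepsilon>0$ one has $\|\vec{\mathbf u}-\mathbf P(\mathbf{FIXPT}[\varepsilon,\mathbf A,\mathbf A_1,\vec{\mathbf l}])\|_{\ell_2(\mathcal N)}\le\varepsilon$, and the number $N$ of iterations to achieve the accuracy $\varepsilon>0$ is estimated by $N\sim-\log(\varepsilon)$ (each quantity is bounded by a constant multiple of the other).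
   Context: **Spaces and frame.** All spaces are real. $(\mathbf V,\mathcal H,\mathbf V')$ is a Gelfand triple of Hilbert spaces: $\mathcal H$ is separable, $\mathbf V\subset\mathcal H\simeq\mathcal H'\subset\mathbf V'$ with bounded dense inclusions, and the duality $\langle\cdot,\cdot\rangle_{\mathbf V'\times\mathbf V}$ is given on $\mathcal H$ by $\langle\cdot,\cdot\rangle_{\mathcal H}$. $\mathcal N$ is a countable index set; $\ell_0(\mathcal N)$ denotes finitely supported sequences. $\mathcal F=\{f_n\}_{n\in\mathcal N}$ is a frame for $\mathcal H$ with a dual frame $\{\tilde f_n\}$ (e.g. the canonical one), so $f=\sum_n\langle f,\tilde f_n\rangle_{\mathcal H} f_n$ for $f\in\mathcal H$. Put $Ff=(\langle f,f_n\rangle)_n$, $F^*\vec{\mathbf c}=\sum_nc_nf_n$, $\tilde Ff=(\langle f,\tilde f_n\rangle)_n$. $\mathcal F$ is a Gelfand frame for $(\mathbf V,\mathcal H,\mathbf V')$: $f_n\in\mathbf V$, $\tilde f_n\in\mathbf V'$, and there is a Gelfand triple of sequence (Hilbert) spaces $(\mathbf V_d,\ell_2(\mathcal N),\mathbf V_d')$ such that $F^*:\mathbf V_d\to\mathbf V$ and $\tilde F:\mathbf V\to\mathbf V_d$ are bounded; by duality $F:\mathbf V'\to\mathbf V_d'$ and $\tilde F^*:\mathbf V_d'\to\mathbf V'$ are bounded. $\|F\|$ is the norm of $F:\mathbf V'\to\mathbf V_d'$ (equal to that of $F^*:\mathbf V_d\to\mathbf V$). $D_{\mathbf V}:\mathbf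 V_d\to\ell_2(\mathcal N)$ is a unitary isomorphism, with $\ell_2$-adjoint isomorphism $D_{\mathbf V}^*:\ell_2(\mathcal N)\to\mathbf V_d'$. **Operators.** $A:\mathbf V\to\mathbf V'$ is linear, bounded, boundedly invertible, and $a(v,w)=\langle Av,w\rangle_{\mathbf V'\times\mathbf V}$ (not necessarily symmetric) satisfies $\alpha\|v\|_{\mathbf V}^2\le a(v,v)\le\beta\|v\|_{\mathbf V}^2$ with $\alpha,\beta>0$. $A_1:\mathbf V\times\mathbf V\to\mathbf V'$ is bounded bilinear with norm $\|A_1\|$; $\ell\in\mathbf V'$. Define $\mathbf A:=(D_{\mathbf V}^* )^{-1}FAF^*D_{\mathbf V}^{-1}$ on $\ell_2(\mathcal N)$, which is bounded and boundedly invertible as a map of its closed range $\operatorname{ran}(\mathbf A)=\operatorname{ran}((D_{\mathbf V}^* )^{-1}F)$ onto itself; $\mathbf P$ = orthogonal projection of $\ell_2(\mathcal N)$ onto $\operatorname{ran}(\mathbf A)$; $\vec{\mathbf l}:=(D_{\mathbf V}^* )^{-1}F\ell\in\operatorname{ran}(\mathbf A)$; $\ \mathbf A_1(\vec{\mathbf v}):=(D_{\mathbf V}^* )^{-1}FA_1(F^*D_{\mathbf V}^{-1}\vec{\mathbf v},F^*D_{\mathbf V}^{-1}\vec{\mathbf v})$; $\ \mathbf H(\vec{\mathbf v}):=(\mathbf A_{|\operatorname{ran}\mathbf A})^{-1}(\vec{\mathbf l}-\mathbf A_1(\vec{\mathbf v}))\in\operatorname{ran}(\mathbf A)$; $\ \boldsymbol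 B_r:=\{\vec{\mathbf u}\in\operatorname{ran}(\mathbf A):\|\vec{\mathbf u}\|_{\ell_2(\mathcal N)}\le r\}$. Under the smallness assumption on $\vec{\mathbf l}$ in the claim one fixes $r^*$ with $0<r^*<(2\|(\mathbf A_{|\operatorname{ran}\mathbf A})^{-1}\|\|F\|^3\|A_1\|)^{-1}$ such that $\mathbf H$ is a contraction of $\boldsymbol B_{r^*}$ into itself (such $r^*$ exists), and $L:=2r^*\|(\mathbf A_{|\operatorname{ran}\mathbf A})^{-1}\|\|F\|^3\|A_1\|<1$. **Procedure SOLVE.** Available are: $\mathbf{RHS}[\varepsilon,\vec{\mathbf f}]\in\ell_0$ approximating $\vec{\mathbf f}\in\ell_2$ up to $\varepsilon$ in $\ell_2$; $\mathbf{APPLY}[\varepsilon,\mathbf M,\vec{\mathbf v}]\in\ell_0$ approximating $\mathbf M\vec{\mathbf v}$ up to $\varepsilon$, for $\mathbf M$ bounded and $\vec{\mathbf v}\in\ell_0$; $\mathbf{COARSE}[\varepsilon,\vec{\mathbf v}]\in\ell_0$ approximating $\vec{\mathbf v}\in\ell_0$ up to $\varepsilon$. Fix $0<\alpha^*<2/\|\mathbf A^*\mathbf A\|$, $\rho:=\|(\mathrm{id}-\alpha^*\mathbf A^*\mathbf A)_{|\operatorname{ran}\mathbf A}\|<1$, $0<\theta<1/3$, $K\in\mathbb N$ with $3\rho^K<\theta$. $\mathbf{SOLVE}[\epsilon,\mathbf A,\vec{\mathbf f}]$ (for $\vec{\mathbf f}\in\operatorname{ran}\mathbf A$): start with $j=0$,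 $\vec{\mathbf v}^{(0)}=0$, $\epsilon_0=\|(\mathbf A_{|\operatorname{ran}\mathbf A})^{-1}\|\|\vec{\mathbf f}\|$. While $\epsilon_j>\epsilon$: increase $j$ by 1; $\epsilon_j:=3\rho^K\epsilon_{j-1}/\theta$; $\vec{\mathbf g}^{(j)}:=\mathbf{RHS}[\frac{\theta\epsilon_j}{12\alpha^*K\|\mathbf A^*\|},\vec{\mathbf f}]$; $\vec{\mathbf f}^{(j)}:=\mathbf{APPLY}[\frac{\theta\epsilon_j}{12\alpha^*K},\mathbf A^*,\vec{\mathbf g}^{(j)}]$; $\vec{\mathbf v}^{(j,0)}:=\vec{\mathbf v}^{(j-1)}$; for $k=1,\dots,K$: $\vec{\mathbf w}^{(j,k-1)}:=\mathbf{APPLY}[\frac{\theta\epsilon_j}{12\alpha^*K\|\mathbf A^*\|},\mathbf A,\vec{\mathbf v}^{(j,k-1)}]$ and $\vec{\mathbf v}^{(j,k)}:=\vec{\mathbf v}^{(j,k-1)}-\alpha^*(\mathbf{APPLY}[\frac{\theta\epsilon_j}{12\alpha^*K},\mathbf A^*,\vec{\mathbf w}^{(j,k-1)}]-\vec{\mathbf f}^{(j)})$; then $\vec{\mathbf v}^{(j)}:=\mathbf{COARSE}[(1-\theta)\epsilon_j,\vec{\mathbf v}^{(j,K)}]$. The output is the last $\vec{\mathbf v}^{(j)}$; it is finitely supported and satisfies $\|\mathbf P\,\mathbf{SOLVE}[\epsilon,\mathbf A,\vec{\mathbf f}]-(\mathbf A_{|\operatorname{ran}\mathbf A})^{-1}\vec{\mathbf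 f}\|_{\ell_2(\mathcal N)}\le\epsilon$. **Procedure FIXPT.** $\mathbf{FIXPT}[\varepsilon,\mathbf A,\mathbf A_1,\vec{\mathbf l}]$: choose $0<\varepsilon_0<r^*$, $\varepsilon_0\ne L$; set $i:=0$, $\vec{\mathbf v}_0:=0$. While $\varepsilon_i>\frac{\varepsilon_0-L}{\varepsilon_0(\varepsilon_0-L(L/\varepsilon_0)^i)}(\varepsilon-L^ir^* )$ do: $\varepsilon_{i+1}:=\varepsilon_0^{i+1}$; $\vec{\mathbf v}_{i+1}:=\mathbf{SOLVE}[\varepsilon_{i+1},\mathbf A,\vec{\mathbf l}-\mathbf A_1(\vec{\mathbf v}_i)]$; $i:=i+1$. When the loop is exited, the output is $\vec{\mathbf v}_i$. For $\varepsilon=0$ the iteration is understood as continued indefinitely, and $\mathbf P(\mathbf{FIXPT}[0,\dots])$ stands for $\lim_n\mathbf P\vec{\mathbf v}_n$. Empty sums are zero.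
   Formalization: FIXPT left at index i is taken to return v_{i+1} (matching part (2)), since with output v_i the accuracy claim in (3) fails; RHS, APPLY and COARSE with tolerance 0, requested only if ρ=0, are read as exact evaluation. *)

theory Defs
  imports "HOL-Analysis.Analysis" "HOL-Library.Landau_Symbols"
begin

section \<open>The sequence space $\ell_2$\<close>

typedef 'n ell2 = "{x :: 'n \<Rightarrow> real. (\<lambda>i. x i * x i) summable_on UNIV}"
  morphisms coord Abs_ell2
  by (rule exI [of _ "\<lambda>_. 0"]) simp

setup_lifting type_definition_ell2

lemma summable_mult_of_squares:
  fixes f g :: "'n \<Rightarrow> real"
  assumes f: "(\<lambda>i. f i * f i) summable_on UNIV" and g: "(\<lambda>i. g i * g i) summable_on UNIV"
  shows "(\<lambda>i. f i * g i) summable_on UNIV"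
  by (rule abs_summable_summable, rule abs_summable_product) (use f g in simp_all)

lemma summable_coord_mult: "(\<lambda>i. coord x i * coord y i) summable_on UNIV"
  using coord [of x] coord [of y] by (auto intro: summable_mult_of_squares)

lemma ell2_eqI: "(\<And>i. coord x i = coord y i) \<Longrightarrow> x = y"
  by (simp add: coord_inject [symmetric] fun_eq_iff)

lemma ell2_add_closed:
  fixes f g :: "'n \<Rightarrow> real"
  assumes f: "(\<lambda>i. f i * f i) summable_on UNIV" and g: "(\<lambda>i. g i * g i) summable_on UNIV"
  shows "(\<lambda>i. (f i + g i) * (f i + g i)) summable_on UNIV"
proof -
  have "(\<lambda>i. f i * g i) summable_on UNIV"
    by (rule summable_mult_of_squares [OF f g])
  then have "(\<lambda>i. f i * f i + g i * g i + 2 * (f i * g i)) summable_on UNIV"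
    by (intro summable_on_add summable_on_cmult_right f g)
  then show ?thesis
    by (simp add: algebra_simps)
qed

lemma ell2_scale_closed:
  fixes f :: "'n \<Rightarrow> real"
  assumes "(\<lambda>i. f i * f i) summable_on UNIV"
  shows "(\<lambda>i. (c * f i) * (c * f i)) summable_on UNIV"
  using summable_on_cmult_right [OF assms, of "c * c"] by (simp add: algebra_simps)

instantiation ell2 :: (type) real_vector
begin

lift_definition zero_ell2 :: "'a ell2" is "\<lambda>_. 0" by simp

lift_definition plus_ell2 :: "'a ell2 \<Rightarrow> 'a ell2 \<Rightarrow> 'a ell2" is "\<lambda>x y i. x i + y i"
  by (rule ell2_add_closed)

lift_definition uminus_ell2 :: "'a ell2 \<Rightarrow> 'a ell2" is "\<lambda>x i. - x i"
  by simp

lift_definition scaleR_ell2 :: "real \<Rightarrow> 'a ell2 \<Rightarrow> 'a ell2" is "\<lambda>c x i. c * x i"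
  by (rule ell2_scale_closed)

definition minus_ell2 :: "'a ell2 \<Rightarrow> 'a ell2 \<Rightarrow> 'a ell2" where
  "minus_ell2 x y = x + - y"

instance
  by standard
    (rule ell2_eqI, simp add: plus_ell2.rep_eq zero_ell2.rep_eq uminus_ell2.rep_eq
      scaleR_ell2.rep_eq minus_ell2_def distrib_left distrib_right)+

end

lemma coord_simps [simp]:
  "coord 0 i = 0" "coord (x + y) i = coord x i + coord y i"
  "coord (- x) i = - coord x i" "coord (x - y) i = coord x i - coord y i"
  "coord (c *\<^sub>R x) i = c * coord x i"
  by (simp_all add: plus_ell2.rep_eq zero_ell2.rep_eq uminus_ell2.rep_eq scaleR_ell2.rep_eq
      minus_ell2_def del: add_uminus_conv_diff)

instantiation ell2 :: (type) real_inner
begin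

definition inner_ell2 :: "'a ell2 \<Rightarrow> 'a ell2 \<Rightarrow> real" where
  "inner_ell2 x y = (\<Sum>\<^sub>\<infinity>i. coord x i * coord y i)"

definition norm_ell2 :: "'a ell2 \<Rightarrow> real" where
  "norm_ell2 x = sqrt (inner x x)"

definition sgn_ell2 :: "'a ell2 \<Rightarrow> 'a ell2" where
  "sgn_ell2 x = x /\<^sub>R norm x"

definition dist_ell2 :: "'a ell2 \<Rightarrow> 'a ell2 \<Rightarrow> real" where
  "dist_ell2 x y = norm (x - y)"

definition uniformity_ell2 :: "('a ell2 \<times> 'a ell2) filter" where
  "uniformity_ell2 = (INF e\<in>{0 <..}. principal {(x, y). dist x y < e})"

definition open_ell2 :: "'a ell2 set \<Rightarrow> bool" where
  "open_ell2 U \<longleftrightarrow> (\<forall>x\<in>U. eventually (\<lambda>(x', y). x' = x \<longrightarrow> y \<in> U) uniformity)"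

instance
proof
  fix x y z :: "'a ell2" and r :: real
  show "inner x y = inner y x"
    by (simp add: inner_ell2_def mult.commute)
  show "inner (x + y) z = inner x z + inner y z"
    by (simp add: inner_ell2_def distrib_right infsum_add summable_coord_mult)
  show "inner (r *\<^sub>R x) y = r * inner x y"
    by (simp add: inner_ell2_def mult.assoc infsum_cmult_right summable_coord_mult)
  show "0 \<le> inner x x"
    by (simp add: inner_ell2_def infsum_nonneg)
  show "inner x x = 0 \<longleftrightarrow> x = 0"
  proof
    assume "inner x x = 0"
    then have "coord x i * coord x i = 0" for i
      using nonneg_infsum_le_0D [of "\<lambda>i. coord x i * coord x i" UNIV i]
      by (simp add: inner_ell2_def summable_coord_mult)
    then show "x = 0"
      by (intro ell2_eqI) simp
  qed (simp add: inner_ell2_def)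
  show "norm x = sqrt (inner x x)" by (rule norm_ell2_def)
  show "sgn x = x /\<^sub>R norm x" by (rule sgn_ell2_def)
  show "dist x y = norm (x - y)" by (rule dist_ell2_def)
  show "(uniformity :: ('a ell2 \<times> 'a ell2) filter)
      = (INF e\<in>{0 <..}. principal {(x, y). dist x y < e})"
    by (rule uniformity_ell2_def)
  show "open U \<longleftrightarrow> (\<forall>x\<in>U. eventually (\<lambda>(x', y). x' = x \<longrightarrow> y \<in> U) uniformity)"
    for U :: "'a ell2 set"
    by (rule open_ell2_def)
qed

end

lemma sum_coord_le_norm:
  assumes "finite I" shows "(\<Sum>i\<in>I. (coord x i)\<^sup>2) \<le> (norm x)\<^sup>2"
proof -
  have "(\<Sum>i\<in>I. coord x i * coord x i) \<le> inner x x"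
    unfolding inner_ell2_def using assms
    by (intro finite_sum_le_infsum) (auto simp: summable_coord_mult)
  then show ?thesis
    unfolding power2_norm_eq_inner by (simp only: power2_eq_square)
qed

instance ell2 :: (type) complete_space
proof
  fix X :: "nat \<Rightarrow> 'a ell2"
  assume X: "Cauchy X"
  have coord_le: "\<bar>coord x i\<bar> \<le> norm x" for x :: "'a ell2" and i
    using sum_coord_le_norm [of "{i}" x] abs_le_square_iff [of "coord x i" "norm x"] by simp
  have "Cauchy (\<lambda>n. coord (X n) i)" for i
    unfolding Cauchy_iff
  proof (intro allI impI)
    fix e :: real assume "0 < e"
    then obtain N where "\<forall>m\<ge>N. \<forall>n\<ge>N. norm (X m - X n) < e"
      using X unfolding Cauchy_iff by blast
    then show "\<exists>N. \<forall>m\<ge>N. \<forall>n\<ge>N. norm (coord (X m) i - coord (X n) i) < e"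
      using coord_le [of "X _ - X _" i] by (metis coord_simps(4) le_less_trans real_norm_def)
  qed
  then have "\<exists>l. (\<lambda>n. coord (X n) i) \<longlonglongrightarrow> l" for i
    by (simp add: Cauchy_convergent_iff convergent_def)
  then obtain l where l: "\<And>i. (\<lambda>n. coord (X n) i) \<longlonglongrightarrow> l i"
    by metis
  have tail: "\<exists>N. \<forall>n\<ge>N. \<forall>I. finite I \<longrightarrow> (\<Sum>i\<in>I. (coord (X n) i - l i)\<^sup>2) \<le> e\<^sup>2"
    if "0 < e" for e
  proof -
    obtain N where N: "\<And>m n. m \<ge> N \<Longrightarrow> n \<ge> N \<Longrightarrow> norm (X m - X n) < e"
      using X \<open>0 < e\<close> unfolding Cauchy_iff by blast
    show ?thesis
    proof (intro exI allI impI)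
      fix n I assume n: "N \<le> n" and I: "finite (I :: 'a set)"
      have "(\<Sum>i\<in>I. (coord (X n) i - coord (X m) i)\<^sup>2) \<le> e\<^sup>2" if "m \<ge> N" for m
      proof -
        have "(\<Sum>i\<in>I. (coord (X n) i - coord (X m) i)\<^sup>2) \<le> (norm (X n - X m))\<^sup>2"
          using sum_coord_le_norm [OF I, of "X n - X m"] by simp
        also have "\<dots> \<le> e\<^sup>2"
          using N [OF n that] by (intro power_mono) auto
        finally show ?thesis .
      qed
      moreover have "(\<lambda>m. \<Sum>i\<in>I. (coord (X n) i - coord (X m) i)\<^sup>2)
          \<longlonglongrightarrow> (\<Sum>i\<in>I. (coord (X n) i - l i)\<^sup>2)"
        by (intro tendsto_intros l)
      ultimately show "(\<Sum>i\<in>I. (coord (X n) i - l i)\<^sup>2) \<le> e\<^sup>2"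
        by (intro LIMSEQ_le_const2) auto
    qed
  qed
  have summ: "(\<lambda>i. (coord (X n) i - l i) * (coord (X n) i - l i)) summable_on UNIV"
    if "\<forall>I. finite I \<longrightarrow> (\<Sum>i\<in>I. (coord (X n) i - l i)\<^sup>2) \<le> e\<^sup>2" for n e
    using that
    by (intro nonneg_bdd_above_summable_on bdd_aboveI [of _ "e\<^sup>2"])
      (auto simp: power2_eq_square)
  obtain N where N: "\<forall>I. finite I \<longrightarrow> (\<Sum>i\<in>I. (coord (X N) i - l i)\<^sup>2) \<le> 1\<^sup>2"
    using tail [of 1] by auto
  have "(\<lambda>i. l i * l i) summable_on UNIV"
    using ell2_add_closed [OF coord [of "X N", simplified]
        ell2_scale_closed [OF summ [OF N], of "-1"]] by simp
  then have L: "coord (Abs_ell2 l) = l"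
    by (simp add: Abs_ell2_inverse)
  have "X \<longlonglongrightarrow> Abs_ell2 l"
    unfolding LIMSEQ_iff
  proof (intro allI impI)
    fix e :: real assume "0 < e"
    then obtain M where M: "\<And>n. n \<ge> M \<Longrightarrow>
        \<forall>I. finite I \<longrightarrow> (\<Sum>i\<in>I. (coord (X n) i - l i)\<^sup>2) \<le> (e/2)\<^sup>2"
      using tail [of "e/2"] by auto
    show "\<exists>M. \<forall>n\<ge>M. norm (X n - Abs_ell2 l) < e"
    proof (intro exI allI impI)
      fix n assume n: "M \<le> n"
      have "inner (X n - Abs_ell2 l) (X n - Abs_ell2 l) \<le> (e/2)\<^sup>2"
        unfolding inner_ell2_def using M [OF n] summ [OF M [OF n]]
        by (intro infsum_le_finite_sums) (auto simp: L power2_eq_square)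
      then have "(norm (X n - Abs_ell2 l))\<^sup>2 \<le> (e/2)\<^sup>2"
        by (simp add: dot_square_norm)
      then have "norm (X n - Abs_ell2 l) \<le> e/2"
        using \<open>0 < e\<close> by (simp add: power2_le_iff_abs_le)
      then show "norm (X n - Abs_ell2 l) < e"
        using \<open>0 < e\<close> by simp
    qed
  qed
  then show "convergent X"
    by (auto simp: convergent_def)
qed

definition ell0 :: "'n ell2 set" where
  "ell0 = {x. finite {i. coord x i \<noteq> 0}}"


section \<open>Gelfand triples and Gelfand frames\<close>

text \<open>
  Hilbert spaces are types of sort \<open>{real_inner, complete_space}\<close>. The dual of \<open>'v\<close> is
  \<open>'v \<Rightarrow>\<^sub>L real\<close> with its operator norm, the duality pairing is application, and an inclusion
  of Hilbert spaces is an injective bounded linear map \<open>J\<close>. With \<open>\<H>\<close> identified with its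
  dual, \<open>hilbert_dual T\<close> is the dual map of \<open>T : \<V> \<rightarrow> \<H>\<close>, from \<open>\<H>\<close> to \<open>\<V>'\<close>;
  for the inclusion \<open>J\<close> it is the inclusion of \<open>\<H>\<close> into \<open>\<V>'\<close>.
\<close>

definition hilbert_dual ::
  "('v::{real_inner,complete_space} \<Rightarrow>\<^sub>L 'h::{real_inner,complete_space}) \<Rightarrow> 'h \<Rightarrow> ('v \<Rightarrow>\<^sub>L real)"
  where "hilbert_dual T x = blinfun_inner_right x o\<^sub>L T"

definition gelfand_triple ::
  "('v::{real_inner,complete_space} \<Rightarrow>\<^sub>L 'h::{real_inner,complete_space}) \<Rightarrow> bool"
  where "gelfand_triple J \<longleftrightarrow>
    inj (blinfun_apply J) \<and> closure (range (blinfun_apply J)) = UNIV \<and>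
    inj (hilbert_dual J) \<and> closure (range (hilbert_dual J)) = UNIV"

definition is_frame :: "('n \<Rightarrow> 'h::{real_inner,complete_space}) \<Rightarrow> bool" where
  "is_frame f \<longleftrightarrow> (\<exists>a b. 0 < a \<and> 0 < b \<and>
     (\<forall>h. (\<lambda>n. (h \<bullet> f n)\<^sup>2) summable_on UNIV \<and>
          a * (norm h)\<^sup>2 \<le> (\<Sum>\<^sub>\<infinity>n. (h \<bullet> f n)\<^sup>2) \<and>
          (\<Sum>\<^sub>\<infinity>n. (h \<bullet> f n)\<^sup>2) \<le> b * (norm h)\<^sup>2))"

definition dual_frames ::
  "('n \<Rightarrow> 'h::{real_inner,complete_space}) \<Rightarrow> ('n \<Rightarrow> 'h) \<Rightarrow> bool" where
  "dual_frames f f' \<longleftrightarrow> is_frame f \<and> is_frame f' \<and>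
     (\<forall>h. ((\<lambda>n. (h \<bullet> f' n) *\<^sub>R f n) has_sum h) UNIV)"

text \<open>
  \<open>J\<close> includes \<open>\<V>\<close> in \<open>\<H>\<close> and \<open>Jd\<close> includes \<open>\<V>\<^sub>d\<close> in \<open>\<ell>\<^sub>2\<close>, so \<open>coord (Jd c)\<close> is the
  sequence that \<open>c\<close> stands for. \<open>Fs\<close> is \<open>F\<^sup>*\<close> and \<open>Ft\<close> is the analysis operator of the dual
  frame; being of type \<open>\<Rightarrow>\<^sub>L\<close> they are bounded. The dual frame lies in \<open>\<H>\<close>, hence in \<open>\<V>'\<close>.
\<close>

definition gelfand_frame ::
  "('v::{real_inner,complete_space} \<Rightarrow>\<^sub>L 'h::{real_inner,complete_space}) \<Rightarrow>
   ('d::{real_inner,complete_space} \<Rightarrow>\<^sub>L 'n ell2) \<Rightarrow>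
   ('n \<Rightarrow> 'h) \<Rightarrow> ('n \<Rightarrow> 'h) \<Rightarrow> ('d \<Rightarrow>\<^sub>L 'v) \<Rightarrow> ('v \<Rightarrow>\<^sub>L 'd) \<Rightarrow> bool"
  where "gelfand_frame J Jd f f' Fs Ft \<longleftrightarrow>
    gelfand_triple J \<and> gelfand_triple Jd \<and> dual_frames f f' \<and> (\<forall>n. f n \<in> range (blinfun_apply J)) \<and>
    (\<forall>c. ((\<lambda>n. coord (Jd c) n *\<^sub>R f n) has_sum J (Fs c)) UNIV) \<and>
    (\<forall>v n. coord (Jd (Ft v)) n = J v \<bullet> f' n)"

definition unitary_iso ::
  "('a::{real_inner,complete_space} \<Rightarrow>\<^sub>L 'b::{real_inner,complete_space}) \<Rightarrow> bool"
  where "unitary_iso D \<longleftrightarrow>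
    bij (blinfun_apply D) \<and> (\<forall>x y. D x \<bullet> D y = x \<bullet> y)"

text \<open>\<open>F : \<V>' \<rightarrow> \<V>\<^sub>d'\<close>, obtained from \<open>F\<^sup>*\<close> by duality\<close>

definition analysis ::
  "('d::{real_inner,complete_space} \<Rightarrow>\<^sub>L 'v::{real_inner,complete_space}) \<Rightarrow>
   ('v \<Rightarrow>\<^sub>L real) \<Rightarrow> ('d \<Rightarrow>\<^sub>L real)"
  where "analysis Fs \<phi> = \<phi> o\<^sub>L Fs"


section \<open>Discretization\<close>

text \<open>\<open>(D\<^sup>*)\<^sup>-\<^sup>1 F\<close> and \<open>F\<^sup>* D\<^sup>-\<^sup>1\<close>\<close>

definition to_coeff ::
  "('d \<Rightarrow>\<^sub>L 'n ell2) \<Rightarrow> ('d::{real_inner,complete_space} \<Rightarrow>\<^sub>L 'v::{real_inner,complete_space}) \<Rightarrow>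
   ('v \<Rightarrow>\<^sub>L real) \<Rightarrow> 'n ell2"
  where "to_coeff D Fs \<phi> = inv (hilbert_dual D) (analysis Fs \<phi>)"

definition from_coeff ::
  "('d \<Rightarrow>\<^sub>L 'n ell2) \<Rightarrow> ('d::{real_inner,complete_space} \<Rightarrow>\<^sub>L 'v::{real_inner,complete_space}) \<Rightarrow>
   'n ell2 \<Rightarrow> 'v"
  where "from_coeff D Fs x = Fs (inv (blinfun_apply D) x)"

definition discretize_linear ::
  "('d \<Rightarrow>\<^sub>L 'n ell2) \<Rightarrow> ('d::{real_inner,complete_space} \<Rightarrow>\<^sub>L 'v::{real_inner,complete_space}) \<Rightarrow>
   ('v \<Rightarrow>\<^sub>L ('v \<Rightarrow>\<^sub>L real)) \<Rightarrow> 'n ell2 \<Rightarrow> 'n ell2"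
  where "discretize_linear D Fs A x = to_coeff D Fs (A (from_coeff D Fs x))"

definition discretize_bilinear ::
  "('d \<Rightarrow>\<^sub>L 'n ell2) \<Rightarrow> ('d::{real_inner,complete_space} \<Rightarrow>\<^sub>L 'v::{real_inner,complete_space}) \<Rightarrow>
   ('v \<Rightarrow>\<^sub>L 'v \<Rightarrow>\<^sub>L ('v \<Rightarrow>\<^sub>L real)) \<Rightarrow> 'n ell2 \<Rightarrow> 'n ell2"
  where "discretize_bilinear D Fs A1 x =
    to_coeff D Fs (A1 (from_coeff D Fs x) (from_coeff D Fs x))"

definition orth_proj :: "'a::real_inner set \<Rightarrow> 'a \<Rightarrow> 'a" where
  "orth_proj S x = (THE y. y \<in> S \<and> (\<forall>z\<in>S. (x - y) \<bullet> z = 0))"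

text \<open>Operator norm of the restriction of \<open>f\<close> to the subspace \<open>S\<close>; the quotient is \<open>0\<close> at \<open>0\<close>.\<close>

definition onorm_on :: "'a::real_normed_vector set \<Rightarrow> ('a \<Rightarrow> 'b::real_normed_vector) \<Rightarrow> real" where
  "onorm_on S f = (SUP x\<in>S. norm (f x) / norm x)"

definition range_inv :: "('a \<Rightarrow> 'a) \<Rightarrow> 'a \<Rightarrow> 'a" where
  "range_inv M = inv_into (range M) M"

abbreviation range_inv_norm :: "('n ell2 \<Rightarrow> 'n ell2) \<Rightarrow> real" where
  "range_inv_norm M \<equiv> onorm_on (range M) (range_inv M)"

definition fixpt_map ::
  "('n ell2 \<Rightarrow> 'n ell2) \<Rightarrow> ('n ell2 \<Rightarrow> 'n ell2) \<Rightarrow> 'n ell2 \<Rightarrow> 'n ell2 \<Rightarrow> 'n ell2"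
  where "fixpt_map M M1 l v = range_inv M (l - M1 v)"

definition range_ball :: "('n ell2 \<Rightarrow> 'n ell2) \<Rightarrow> real \<Rightarrow> 'n ell2 set" where
  "range_ball M r = {u \<in> range M. norm u \<le> r}"


section \<open>Building blocks and SOLVE\<close>

text \<open>
  Zero tolerance means exact evaluation, without finite support. SOLVE asks for it only in the
  degenerate case \<open>\<rho> = 0\<close>, where its tolerances vanish.
\<close>

definition rhs_routine :: "(real \<Rightarrow> 'n ell2 \<Rightarrow> 'n ell2) \<Rightarrow> bool" where
  "rhs_routine RHS \<longleftrightarrow>
    (\<forall>\<epsilon>>0. \<forall>f. RHS \<epsilon> f \<in> ell0 \<and> norm (RHS \<epsilon> f - f) \<le> \<epsilon>) \<and>
    (\<forall>f. RHS 0 f = f)"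

definition apply_routine ::
  "(real \<Rightarrow> ('n ell2 \<Rightarrow> 'n ell2) \<Rightarrow> 'n ell2 \<Rightarrow> 'n ell2) \<Rightarrow> bool" where
  "apply_routine APPLY \<longleftrightarrow>
    (\<forall>\<epsilon>>0. \<forall>M. bounded_linear M \<longrightarrow>
       (\<forall>v\<in>ell0. APPLY \<epsilon> M v \<in> ell0 \<and> norm (APPLY \<epsilon> M v - M v) \<le> \<epsilon>)) \<and>
    (\<forall>M. bounded_linear M \<longrightarrow> (\<forall>v. APPLY 0 M v = M v))"

definition coarse_routine :: "(real \<Rightarrow> 'n ell2 \<Rightarrow> 'n ell2) \<Rightarrow> bool" where
  "coarse_routine COARSE \<longleftrightarrow>
    (\<forall>\<epsilon>>0. \<forall>v\<in>ell0. COARSE \<epsilon> v \<in> ell0 \<and> norm (COARSE \<epsilon> v - v) \<le> \<epsilon>) \<and>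
    (\<forall>v. COARSE 0 v = v)"

definition richardson_rate :: "('n ell2 \<Rightarrow> 'n ell2) \<Rightarrow> real \<Rightarrow> real" where
  "richardson_rate M \<alpha> = onorm_on (range M) (\<lambda>x. x - \<alpha> *\<^sub>R adjoint M (M x))"

text \<open>The pair of \<open>\<epsilon>\<^sub>j\<close> and the iterate \<open>v\<^sup>(\<^sup>j\<^sup>)\<close>, disregarding the stopping test\<close>

primrec solve_state ::
  "(real \<Rightarrow> 'n ell2 \<Rightarrow> 'n ell2) \<Rightarrow> (real \<Rightarrow> ('n ell2 \<Rightarrow> 'n ell2) \<Rightarrow> 'n ell2 \<Rightarrow> 'n ell2) \<Rightarrow>
   (real \<Rightarrow> 'n ell2 \<Rightarrow> 'n ell2) \<Rightarrow> real \<Rightarrow> real \<Rightarrow> nat \<Rightarrow>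
   ('n ell2 \<Rightarrow> 'n ell2) \<Rightarrow> 'n ell2 \<Rightarrow> nat \<Rightarrow> real \<times> 'n ell2"
where
  "solve_state RHS APPLY COARSE \<alpha> \<theta> K M f 0 = (range_inv_norm M * norm f, 0)"
| "solve_state RHS APPLY COARSE \<alpha> \<theta> K M f (Suc j) =
    (let (e0, v) = solve_state RHS APPLY COARSE \<alpha> \<theta> K M f j;
         e = 3 * richardson_rate M \<alpha> ^ K * e0 / \<theta>;
         t = \<theta> * e / (12 * \<alpha> * real K);
         s = \<theta> * e / (12 * \<alpha> * real K * onorm (adjoint M));
         g = RHS s f;
         fj = APPLY t (adjoint M) g;
         step = (\<lambda>y. y - \<alpha> *\<^sub>R (APPLY t (adjoint M) (APPLY s M y) - fj))
     in (e, COARSE ((1 - \<theta>) * e) ((step ^^ K) v)))"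

definition solve ::
  "(real \<Rightarrow> 'n ell2 \<Rightarrow> 'n ell2) \<Rightarrow> (real \<Rightarrow> ('n ell2 \<Rightarrow> 'n ell2) \<Rightarrow> 'n ell2 \<Rightarrow> 'n ell2) \<Rightarrow>
   (real \<Rightarrow> 'n ell2 \<Rightarrow> 'n ell2) \<Rightarrow> real \<Rightarrow> real \<Rightarrow> nat \<Rightarrow>
   real \<Rightarrow> ('n ell2 \<Rightarrow> 'n ell2) \<Rightarrow> 'n ell2 \<Rightarrow> 'n ell2"
where
  "solve RHS APPLY COARSE \<alpha> \<theta> K \<epsilon> M f =
    (let st = solve_state RHS APPLY COARSE \<alpha> \<theta> K M f
     in snd (st (LEAST j. fst (st j) \<le> \<epsilon>)))"


section \<open>FIXPT\<close>

text \<open>Note that \<open>\<epsilon>\<^sub>0\<close> and \<open>\<epsilon>\<^sub>1\<close> are both the initial tolerance \<open>e0\<close>.\<close>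

definition fixpt_tol :: "real \<Rightarrow> nat \<Rightarrow> real" where
  "fixpt_tol e0 i = (if i = 0 then e0 else e0 ^ i)"

text \<open>\<open>slv \<epsilon> M f\<close> is the procedure SOLVE.\<close>

primrec fixpt_iter ::
  "(real \<Rightarrow> ('n ell2 \<Rightarrow> 'n ell2) \<Rightarrow> 'n ell2 \<Rightarrow> 'n ell2) \<Rightarrow> real \<Rightarrow>
   ('n ell2 \<Rightarrow> 'n ell2) \<Rightarrow> ('n ell2 \<Rightarrow> 'n ell2) \<Rightarrow> 'n ell2 \<Rightarrow> nat \<Rightarrow> 'n ell2"
where
  "fixpt_iter slv e0 M M1 l 0 = 0"
| "fixpt_iter slv e0 M M1 l (Suc i) =
    slv (fixpt_tol e0 (Suc i)) M (l - M1 (fixpt_iter slv e0 M M1 l i))"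

definition fixpt_continues :: "real \<Rightarrow> real \<Rightarrow> real \<Rightarrow> real \<Rightarrow> nat \<Rightarrow> bool" where
  "fixpt_continues e0 L r \<epsilon> i \<longleftrightarrow>
    fixpt_tol e0 i > (e0 - L) / (e0 * (e0 - L * (L / e0) ^ i)) * (\<epsilon> - L ^ i * r)"

definition fixpt_count :: "real \<Rightarrow> real \<Rightarrow> real \<Rightarrow> real \<Rightarrow> nat" where
  "fixpt_count e0 L r \<epsilon> = (LEAST i. \<not> fixpt_continues e0 L r \<epsilon> i)"

text \<open>
  The iterates are counted as in the error estimate: after \<open>n\<close> iterations one has \<open>v\<^bsub>n+1\<^esub>\<close>,
  so a loop left at index \<open>i\<close> returns \<open>v\<^bsub>i+1\<^esub>\<close>. For \<open>i > 0\<close> the stopping test is the statement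
  that the error bound for \<open>v\<^bsub>i+1\<^esub>\<close> is at most \<open>\<epsilon>\<close>; it does not bound the error of \<open>v\<^bsub>i\<^esub>\<close>
  by \<open>\<epsilon>\<close> (for \<open>L = 0\<close> it reads \<open>e0 ^ (i + 1) \<le> \<epsilon>\<close>, while \<open>v\<^bsub>i\<^esub>\<close> is computed to
  accuracy \<open>e0 ^ i\<close>).
\<close>

definition fixpt ::
  "(real \<Rightarrow> ('n ell2 \<Rightarrow> 'n ell2) \<Rightarrow> 'n ell2 \<Rightarrow> 'n ell2) \<Rightarrow> real \<Rightarrow> real \<Rightarrow> real \<Rightarrow>
   real \<Rightarrow> ('n ell2 \<Rightarrow> 'n ell2) \<Rightarrow> ('n ell2 \<Rightarrow> 'n ell2) \<Rightarrow> 'n ell2 \<Rightarrow> 'n ell2"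
where
  "fixpt slv e0 L r \<epsilon> M M1 l = fixpt_iter slv e0 M M1 l (fixpt_count e0 L r \<epsilon> + 1)"

text \<open>
  The projected output. For \<open>\<epsilon> = 0\<close> the loop is run forever and only the limit of the
  projected iterates is meaningful.
\<close>

definition proj_fixpt ::
  "(real \<Rightarrow> ('n ell2 \<Rightarrow> 'n ell2) \<Rightarrow> 'n ell2 \<Rightarrow> 'n ell2) \<Rightarrow> real \<Rightarrow> real \<Rightarrow> real \<Rightarrow>
   real \<Rightarrow> ('n ell2 \<Rightarrow> 'n ell2) \<Rightarrow> ('n ell2 \<Rightarrow> 'n ell2) \<Rightarrow> 'n ell2 \<Rightarrow> 'n ell2"
where
  "proj_fixpt slv e0 L r \<epsilon> M M1 l =
    (if \<epsilon> = 0 then lim (\<lambda>n. orth_proj (range M) (fixpt_iter slv e0 M M1 l n))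
     else orth_proj (range M) (fixpt slv e0 L r \<epsilon> M M1 l))"

text \<open>\<open>c\<close> stands for the product of the norms of the inverse of \<open>\<^bold>A\<close> on its range and of \<open>\<^bold>l\<close>.\<close>

definition fixpt_radius :: "real \<Rightarrow> real \<Rightarrow> real \<Rightarrow> nat \<Rightarrow> real" where
  "fixpt_radius e0 L c n =
    (let \<epsilon> = fixpt_tol e0 in
      (\<Sum>k=2..n+1. \<epsilon> k)
      + (1 + L) * (\<Sum>h | h + 3 \<le> n. \<Sum>k=3..n-h. \<epsilon> k * L ^ (n - h - k))
      + (\<epsilon> 1 + L * (\<epsilon> 0 + c)) * (\<Sum>k<n. L ^ k)
      + \<epsilon> 0 + c)"

end

theory Submission
  imports Defs
begin

text \<open>
  Write \<open>S = F\<^sup>* D\<^sup>-\<^sup>1\<close>. Then \<open>\<langle>\<^bold>A x, y\<rangle> = a(S x, S y)\<close>, and the dual frame provides a bounded right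
  inverse of \<open>S\<close>. Hence \<open>ran \<^bold>A\<close> is the orthogonal complement of \<open>ker S = ker \<^bold>A\<close>, it is closed,
  and \<open>\<^bold>A\<close> is bounded below on it by ellipticity. In SOLVE the perturbed Richardson steps keep the
  projected error below the running tolerance. As \<open>\<^bold>A\<^sub>1\<close> depends on its argument only through
  the projection, \<open>P v\<^bsub>n+1\<^esub>\<close> agrees with \<open>\<^bold>H (P v\<^sub>n)\<close> up to \<open>\<epsilon>\<^bsub>n+1\<^esub>\<close>.

  That the \<open>P v\<^sub>n\<close> stay in the ball follows from the limit of the radius condition:
  it implies \<open>2 \<epsilon>\<^sub>0 + c + L r \<le> r\<close>, where \<open>c = \<parallel>\<^bold>A\<^sup>-\<^sup>1\<parallel> \<parallel>\<^bold>l\<parallel>\<close>, while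
  \<open>\<parallel>\<^bold>H x\<parallel> \<le> c + L r\<close> on the ball. There \<open>\<^bold>H\<close> is \<open>L\<close>-Lipschitz, so the error
  \<open>d\<^sub>n = \<parallel>P v\<^sub>n - u\<parallel>\<close> satisfies \<open>d\<^bsub>n+1\<^esub> \<le> \<epsilon>\<^sub>0\<^sup>n\<^sup>+\<^sup>1 + L d\<^sub>n\<close>. The first term of the stated bound
  is the solution of this recursion with equality, started from \<open>\<epsilon>\<^sub>0\<close>.
  It lies between \<open>\<epsilon>\<^sub>0\<^sup>n\<^sup>+\<^sup>1\<close> and a multiple of \<open>(max \<epsilon>\<^sub>0 L)\<^sup>n\<close>,
  which makes the iteration count logarithmic.
\<close>

section \<open>Orthogonal projections and adjoints\<close>

text \<open>A minimizing sequence for the distance from \<open>x\<close> to \<open>U\<close> is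
  Cauchy by the parallelogram law; its limit is the projection.\<close>

lemma closed_subspace_projection:
  fixes U :: "'a::{real_inner,complete_space} set"
  assumes U: "subspace U" "closed U"
  obtains y where "y \<in> U" "\<And>z. z \<in> U \<Longrightarrow> (x - y) \<bullet> z = 0"
proof -
  define \<delta> where "\<delta> = (INF z\<in>U. (norm (x - z))\<^sup>2)"
  have bdd: "bdd_below ((\<lambda>z. (norm (x - z))\<^sup>2) ` U)"
    by (rule bdd_belowI [of _ 0]) auto
  have \<delta>_le: "\<delta> \<le> (norm (x - z))\<^sup>2" if "z \<in> U" for z
    unfolding \<delta>_def by (rule cINF_lower [OF bdd that])
  have "\<exists>z\<in>U. (norm (x - z))\<^sup>2 < \<delta> + inverse (real (Suc n))" for n
    using cInf_lessD [of "(\<lambda>z. (norm (x - z))\<^sup>2) ` U" "\<delta> + inverse (real (Suc n))"] U(1)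
    unfolding \<delta>_def by (auto simp: subspace_def)
  then obtain z where z: "\<And>n. z n \<in> U"
    and z_le: "\<And>n. (norm (x - z n))\<^sup>2 < \<delta> + inverse (real (Suc n))"
    by metis
  have dist_z: "(norm (z m - z n))\<^sup>2 \<le> 2 * inverse (real (Suc m)) + 2 * inverse (real (Suc n))"
    for m n
  proof -
    \<comment> \<open>The midpoint lies in \<open>U\<close>, so its squared distance to
      \<open>x\<close> is at least \<open>\<delta>\<close>; the parallelogram identity turns this
      into a bound on \<open>z m - z n\<close>.\<close>
    have "(1/2) *\<^sub>R (z m + z n) \<in> U"
      using U(1) z by (simp add: subspace_add subspace_scale)
    from \<delta>_le [OF this] have "4 * \<delta> \<le> 4 * (norm (x - (1/2) *\<^sub>R (z m + z n)))\<^sup>2"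
      by simp
    also have "\<dots> = 2 * (norm (x - z m))\<^sup>2 + 2 * (norm (x - z n))\<^sup>2 - (norm (z m - z n))\<^sup>2"
      unfolding power2_norm_eq_inner
      by (simp add: inner_commute algebra_simps)
    finally show ?thesis
      using z_le [of m] z_le [of n] by linarith
  qed
  have "Cauchy z"
    unfolding Cauchy_iff
  proof (intro allI impI)
    fix e :: real assume e: "0 < e"
    then obtain N where N: "inverse (real (Suc N)) < e\<^sup>2 / 4"
      using reals_Archimedean [of "e\<^sup>2 / 4"] by auto
    show "\<exists>N. \<forall>m\<ge>N. \<forall>n\<ge>N. norm (z m - z n) < e"
    proof (intro exI allI impI)
      fix m n assume "N \<le> m" "N \<le> n"
      then have "inverse (real (Suc m)) \<le> inverse (real (Suc N))"
        "inverse (real (Suc n)) \<le> inverse (real (Suc N))"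
        by (simp_all add: le_imp_inverse_le)
      then have "(norm (z m - z n))\<^sup>2 < e\<^sup>2"
        using dist_z [of m n] N by linarith
      then show "norm (z m - z n) < e"
        using e by (simp add: power_less_imp_less_base)
    qed
  qed
  then obtain y where y: "z \<longlonglongrightarrow> y"
    by (auto simp: Cauchy_convergent_iff convergent_def)
  have "y \<in> U"
    using U(2) z y closed_sequentially by blast
  have "(norm (x - y))\<^sup>2 \<le> \<delta>"
  proof (rule LIMSEQ_le)
    show "(\<lambda>n. (norm (x - z n))\<^sup>2) \<longlonglongrightarrow> (norm (x - y))\<^sup>2"
      by (intro tendsto_intros y)
    show "(\<lambda>n. \<delta> + inverse (real (Suc n))) \<longlonglongrightarrow> \<delta>"
      using tendsto_add [OF tendsto_const [of \<delta>] LIMSEQ_inverse_real_of_nat] by simp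
  qed (use z_le less_imp_le in blast)
  have "(x - y) \<bullet> w = 0" if w: "w \<in> U" for w
  proof (cases "w = 0")
    case False
    \<comment> \<open>This \<open>t\<close> minimizes the distance from \<open>x\<close> along the
      line through \<open>y\<close> in direction \<open>w\<close>.\<close>
    define t where "t = ((x - y) \<bullet> w) / (w \<bullet> w)"
    have "y + t *\<^sub>R w \<in> U"
      using U(1) \<open>y \<in> U\<close> w by (simp add: subspace_add subspace_scale)
    from \<delta>_le [OF this] have "(norm (x - y))\<^sup>2 \<le> (norm (x - (y + t *\<^sub>R w)))\<^sup>2"
      using \<open>(norm (x - y))\<^sup>2 \<le> \<delta>\<close> by linarith
    also have "\<dots> = (norm (x - y))\<^sup>2 - 2 * t * ((x - y) \<bullet> w) + t * t * (w \<bullet> w)"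
      unfolding power2_norm_eq_inner by (simp add: inner_commute algebra_simps)
    also have "\<dots> = (norm (x - y))\<^sup>2 - ((x - y) \<bullet> w)\<^sup>2 / (w \<bullet> w)"
      using False by (simp add: t_def power2_eq_square field_simps)
    finally have "((x - y) \<bullet> w)\<^sup>2 / (w \<bullet> w) \<le> 0"
      by simp
    then show ?thesis
      using inner_gt_zero_iff [of w] False
      by (auto simp: divide_le_0_iff simp del: inner_gt_zero_iff)
  qed simp
  with \<open>y \<in> U\<close> that show thesis
    by blast
qed

text \<open>The kernel of a nonzero functional is a closed hyperplane; a suitable multiple of a
  vector orthogonal to it represents the functional.\<close>

lemma riesz_representation:
  fixes \<phi> :: "'a::{real_inner,complete_space} \<Rightarrow> real"
  assumes "bounded_linear \<phi>"
  obtains y where "\<And>x. \<phi> x = y \<bullet> x"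
proof -
  interpret \<phi>: bounded_linear \<phi> by fact
  show thesis
  proof (cases "\<forall>x. \<phi> x = 0")
    case True
    then show ?thesis
      using that [of 0] by simp
  next
    case False
    then obtain a where a: "\<phi> a \<noteq> 0"
      by blast
    define U where "U = {x. \<phi> x = 0}"
    have "subspace U"
      by (simp add: U_def subspace_def \<phi>.add \<phi>.scaleR \<phi>.zero)
    moreover have "closed U"
      unfolding U_def by (intro closed_Collect_eq \<phi>.continuous_on continuous_intros)
    ultimately obtain b where b: "b \<in> U" "\<And>z. z \<in> U \<Longrightarrow> (a - b) \<bullet> z = 0"
      by (rule closed_subspace_projection [where x = a]) blast
    define w where "w = a - b"
    have w: "\<phi> w \<noteq> 0" "w \<noteq> 0"
      using a b(1) by (auto simp: w_def U_def \<phi>.diff \<phi>.zero)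
    have "\<phi> x = ((\<phi> w / (w \<bullet> w)) *\<^sub>R w) \<bullet> x" for x
    proof -
      have "x - (\<phi> x / \<phi> w) *\<^sub>R w \<in> U"
        using w by (simp add: U_def \<phi>.diff \<phi>.scaleR)
      then have "w \<bullet> (x - (\<phi> x / \<phi> w) *\<^sub>R w) = 0"
        unfolding w_def by (rule b(2))
      then have "w \<bullet> x = \<phi> x / \<phi> w * (w \<bullet> w)"
        by (simp add: inner_diff_right)
      then show ?thesis
        using w by (simp add: field_simps)
    qed
    then show ?thesis
      by (rule that)
  qed
qed

text \<open>\<open>adjoint\<close> is defined by choice, so it is meaningful only once some adjoint
  exists; the Riesz representation of \<open>\<lambda>x. f x \<bullet> y\<close> provides
  one.\<close>

lemma adjoint_bounded_linear:
  fixes f :: "'a::{real_inner,complete_space} \<Rightarrow> 'b::real_inner"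
  assumes f: "bounded_linear f"
  shows "f x \<bullet> y = x \<bullet> adjoint f y" and "bounded_linear (adjoint f)"
proof -
  have "\<exists>z. \<forall>x. f x \<bullet> y = z \<bullet> x" for y
  proof -
    have "bounded_linear (\<lambda>x. f x \<bullet> y)"
      using bounded_linear_compose [OF bounded_linear_inner_left f] by simp
    then show ?thesis
      using riesz_representation by metis
  qed
  then have "\<exists>f'. \<forall>x y. f x \<bullet> y = x \<bullet> f' y"
    by (metis inner_commute)
  then have adj: "f x \<bullet> y = x \<bullet> adjoint f y" for x y
    unfolding adjoint_def by (rule someI2_ex) blast
  then show "f x \<bullet> y = x \<bullet> adjoint f y" .
  obtain B where B: "0 < B" "\<And>x. norm (f x) \<le> norm x * B"
    using bounded_linear.pos_bounded [OF f] by blast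
  show "bounded_linear (adjoint f)"
  proof (rule bounded_linear_intro)
    show "adjoint f (y + z) = adjoint f y + adjoint f z" for y z
      by (rule vector_eq_ldot [THEN iffD1])
        (simp add: inner_add_right flip: adj)
    show "adjoint f (r *\<^sub>R y) = r *\<^sub>R adjoint f y" for r y
      by (rule vector_eq_ldot [THEN iffD1]) (simp flip: adj)
    show "norm (adjoint f y) \<le> norm y * B" for y
    proof (cases "adjoint f y = 0")
      case False
      have "norm (adjoint f y) * norm (adjoint f y) = f (adjoint f y) \<bullet> y"
        by (simp add: adj flip: dot_square_norm power2_eq_square)
      also have "\<dots> \<le> norm (f (adjoint f y)) * norm y"
        by (rule norm_cauchy_schwarz)
      also have "\<dots> \<le> norm (adjoint f y) * B * norm y"
        by (intro mult_right_mono B) auto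
      finally show ?thesis
        using False by (simp add: mult_ac)
    qed (use B in simp)
  qed
qed

text \<open>A supremum of reals carries information only over a bounded set. Here and in the next
  lemma, \<open>C\<close> is any a priori bound ensuring this.\<close>

lemma onorm_on_nonneg:
  assumes "0 \<in> S" "\<And>x. x \<in> S \<Longrightarrow> norm (f x) \<le> C * norm x"
  shows "0 \<le> onorm_on S f"
proof -
  \<comment> \<open>The maximum with \<open>0\<close> covers the quotient at \<open>x = 0\<close>,
    which is \<open>0\<close> by the convention for division.\<close>
  have "bdd_above ((\<lambda>x. norm (f x) / norm x) ` S)"
    using assms(2) norm_ge_zero by (intro bdd_aboveI [of _ "max C 0"]) (auto simp: divide_simps le_max_iff_disj)
  then show ?thesis
    unfolding onorm_on_def using assms(1) by (intro cSUP_upper2 [of _ _ 0]) auto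
qed

lemma norm_le_onorm_on:
  assumes "x \<in> S" "\<And>x. x \<in> S \<Longrightarrow> norm (f x) \<le> C * norm x"
  shows "norm (f x) \<le> onorm_on S f * norm x"
proof (cases "x = 0")
  case True
  then show ?thesis
    using assms(2) [OF assms(1)] by simp
next
  case False
  have "bdd_above ((\<lambda>x. norm (f x) / norm x) ` S)"
    using assms(2) norm_ge_zero by (intro bdd_aboveI [of _ "max C 0"]) (auto simp: divide_simps le_max_iff_disj)
  then have "norm (f x) / norm x \<le> onorm_on S f"
    unfolding onorm_on_def by (intro cSUP_upper assms(1))
  then show ?thesis
    using False by (simp add: divide_simps)
qed

section \<open>Operators bounded below on their closed range\<close>

locale range_iso =
  fixes M :: "'a::{real_inner,complete_space} \<Rightarrow> 'a" and \<kappa> :: real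
  assumes bounded_linear: "bounded_linear M"
    and closed_range: "closed (range M)"
    and kernel: "M x = 0 \<longleftrightarrow> (\<forall>y. x \<bullet> M y = 0)"
    and \<kappa>: "0 < \<kappa>" "\<kappa> * norm (M x) \<le> norm (M (M x))"
begin

sublocale M: bounded_linear M
  by (rule bounded_linear)

abbreviation "P \<equiv> orth_proj (range M)"
abbreviation "G \<equiv> range_inv M"

lemma subspace_range: "subspace (range M)"
  using subspace_UNIV M.linear_axioms by (rule linear_subspace_image [rotated])

lemma orth_proj_eqI: "P x = y" if "y \<in> range M" "\<And>z. (x - y) \<bullet> M z = 0"
  unfolding orth_proj_def
proof (rule the_equality)
  show "y \<in> range M \<and> (\<forall>z\<in>range M. (x - y) \<bullet> z = 0)"
    using that by auto
  fix w assume w: "w \<in> range M \<and> (\<forall>z\<in>range M. (x - w) \<bullet> z = 0)"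
  have "w - y \<in> range M"
    using w that(1) subspace_range by (simp add: subspace_diff)
  then have "(x - y) \<bullet> (w - y) = 0" "(x - w) \<bullet> (w - y) = 0"
    using w that(2) by auto
  then have "(w - y) \<bullet> (w - y) = 0"
    by (simp add: inner_diff_left)
  then show "w = y" by simp
qed

lemma orth_proj_in: "P x \<in> range M" and orth_proj_orth: "(x - P x) \<bullet> M z = 0"
proof -
  obtain y where y: "y \<in> range M" "\<And>z. z \<in> range M \<Longrightarrow> (x - y) \<bullet> z = 0"
    using closed_subspace_projection [OF subspace_range closed_range, of x] by blast
  then have "P x = y"
    by (intro orth_proj_eqI) auto
  with y show "P x \<in> range M" "(x - P x) \<bullet> M z = 0"
    by auto
qed

lemma orth_proj_id: "x \<in> range M \<Longrightarrow> P x = x"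
  by (rule orth_proj_eqI) auto

lemma orth_proj_0: "P 0 = 0"
  by (intro orth_proj_id subspace_0 subspace_range)

lemma orth_proj_diff: "P (x - y) = P x - P y"
  using orth_proj_orth [of x] orth_proj_orth [of y] orth_proj_in subspace_range
  by (intro orth_proj_eqI) (auto simp: subspace_diff inner_diff_left)

lemma norm_orth_proj: "norm (P x) \<le> norm x"
proof -
  obtain z where z: "P x = M z"
    using orth_proj_in by blast
  have "(x - P x) \<bullet> P x = 0"
    using orth_proj_orth [of x z] z by simp
  then have "P x \<bullet> P x \<le> norm x * norm (P x)"
    by (metis cancel_comm_monoid_add_class.diff_cancel diff_eq_diff_eq inner_diff_left norm_cauchy_schwarz)
  then have "norm (P x) * norm (P x) \<le> norm x * norm (P x)"
    by (simp add: dot_square_norm power2_eq_square)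
  then show ?thesis
    by (cases "P x = 0") auto
qed

text \<open>By \<open>kernel\<close>, \<open>M\<close> annihilates everything orthogonal to its
  range, in particular \<open>x - P x\<close>.\<close>

lemma apply_orth_proj: "M (P x) = M x"
proof -
  have "M (x - P x) = 0"
    using orth_proj_orth by (simp add: kernel)
  then show ?thesis
    by (simp add: M.diff)
qed

lemma inj_on_range: "inj_on M (range M)"
proof (rule inj_onI)
  fix x y assume xy: "x \<in> range M" "y \<in> range M" "M x = M y"
  then obtain z where z: "x - y = M z"
    using subspace_range subspace_diff by blast
  have "M (M z) = 0"
    using xy(3) by (simp add: M.diff flip: z)
  then have "M z = 0"
    using \<kappa>(1) \<kappa>(2) [of z] by (simp add: mult_le_0_iff)
  then show "x = y"
    using z by simp
qed

lemma range_inv_apply: "x \<in> range M \<Longrightarrow> G (M x) = x"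
  unfolding range_inv_def by (rule inv_into_f_f [OF inj_on_range])

lemma image_range: "M ` range M = range M"
proof
  show "range M \<subseteq> M ` range M"
    using apply_orth_proj orth_proj_in by (metis image_eqI image_subsetI)
qed auto

lemma range_inv_in: "y \<in> range M \<Longrightarrow> G y \<in> range M"
  and apply_range_inv: "y \<in> range M \<Longrightarrow> M (G y) = y"
  unfolding range_inv_def by (metis image_range inv_into_into, metis image_range f_inv_into_f)

lemma range_inv_diff: "y \<in> range M \<Longrightarrow> z \<in> range M \<Longrightarrow> G (y - z) = G y - G z"
  using range_inv_apply [of "G y - G z"] range_inv_in subspace_range
  by (simp add: M.diff apply_range_inv subspace_diff)

lemma norm_range_inv_bound: "y \<in> range M \<Longrightarrow> norm (G y) \<le> 1 / \<kappa> * norm y"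
proof -
  assume y: "y \<in> range M"
  then obtain x where x: "G y = M x"
    using range_inv_in by blast
  then have "\<kappa> * norm (G y) \<le> norm y"
    using \<kappa>(2) [of x] apply_range_inv [OF y] by simp
  then show ?thesis
    using \<kappa>(1) by (simp add: field_simps)
qed

lemma norm_range_inv: "y \<in> range M \<Longrightarrow> norm (G y) \<le> onorm_on (range M) G * norm y"
  by (rule norm_le_onorm_on) (auto intro: norm_range_inv_bound)

lemma onorm_range_inv_nonneg: "0 \<le> onorm_on (range M) G"
  by (rule onorm_on_nonneg [OF _ norm_range_inv_bound])
     (use subspace_range subspace_0 in blast)+

text \<open>The adjoint maps into the orthogonal complement of the kernel of \<open>M\<close>, which
  here is the range. Exact Richardson corrections therefore stay in the range.\<close>

lemma adjoint_in_range: "adjoint M y \<in> range M"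
proof -
  let ?x = "adjoint M y"
  have "(?x - P ?x) \<bullet> ?x = M (?x - P ?x) \<bullet> y"
    by (simp add: adjoint_bounded_linear(1) [OF bounded_linear])
  also have "\<dots> = 0"
    by (simp add: M.diff apply_orth_proj)
  moreover have "(?x - P ?x) \<bullet> P ?x = 0"
    using orth_proj_orth orth_proj_in by (metis imageE)
  ultimately have "(?x - P ?x) \<bullet> (?x - P ?x) = 0"
    by (simp add: inner_diff_right)
  then show ?thesis
    using orth_proj_in [of ?x] by simp
qed

text \<open>An a priori bound, so that the supremum defining \<open>richardson_rate\<close> runs
  over a bounded set.\<close>

lemma richardson_bound:
  obtains C where "\<And>x. norm (x - a *\<^sub>R adjoint M (M x)) \<le> C * norm x"
proof -
  have "bounded_linear (\<lambda>x. x - a *\<^sub>R adjoint M (M x))"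
    by (intro bounded_linear_sub bounded_linear_ident bounded_linear_const_scaleR
      bounded_linear_compose [OF adjoint_bounded_linear(2)] bounded_linear)
  from bounded_linear.bounded [OF this] obtain C
    where "\<And>x. norm (x - a *\<^sub>R adjoint M (M x)) \<le> norm x * C"
    by blast
  then show thesis
    by (intro that [of C]) (simp add: mult.commute)
qed

end

section \<open>The procedure SOLVE\<close>

lemma ell0_zero [simp]: "0 \<in> ell0"
  by (simp add: ell0_def)

lemma ell0_diff [intro]: "x \<in> ell0 \<Longrightarrow> y \<in> ell0 \<Longrightarrow> x - y \<in> ell0"
  unfolding ell0_def
  by (auto elim: rev_finite_subset [OF finite_UnI])

lemma ell0_scaleR [intro]: "x \<in> ell0 \<Longrightarrow> a *\<^sub>R x \<in> ell0"
  unfolding ell0_def by (auto elim: rev_finite_subset)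

locale solve_procedure = range_iso M \<kappa>
  for M :: "'n ell2 \<Rightarrow> 'n ell2" and \<kappa> +
  fixes RHS COARSE :: "real \<Rightarrow> 'n ell2 \<Rightarrow> 'n ell2"
    and APPLY :: "real \<Rightarrow> ('n ell2 \<Rightarrow> 'n ell2) \<Rightarrow> 'n ell2 \<Rightarrow> 'n ell2"
    and \<alpha> \<theta> :: real and K :: nat
  assumes routines: "rhs_routine RHS" "apply_routine APPLY" "coarse_routine COARSE"
    and \<alpha>: "0 < \<alpha>" and \<theta>: "0 < \<theta>" "\<theta> < 1/3"
    and K: "3 * richardson_rate M \<alpha> ^ K < \<theta>"
begin

abbreviation "\<rho> \<equiv> richardson_rate M \<alpha>"
abbreviation "N \<equiv> onorm (adjoint M)"
abbreviation "solve_st \<equiv> solve_state RHS APPLY COARSE \<alpha> \<theta> K M"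

lemmas adj_linear = adjoint_bounded_linear(2) [OF bounded_linear]

sublocale adj: bounded_linear "adjoint M"
  by (rule adj_linear)

lemma norm_adjoint: "norm (adjoint M x) \<le> N * norm x"
  by (rule onorm [OF adj_linear])

lemma RHS_error: "0 \<le> s \<Longrightarrow> norm (RHS s f - f) \<le> s"
  and RHS_ell0: "0 < s \<Longrightarrow> RHS s f \<in> ell0"
  using routines(1) by (auto simp: rhs_routine_def le_less)

lemma APPLY_error:
  "bounded_linear B \<Longrightarrow> 0 \<le> s \<Longrightarrow> s = 0 \<or> x \<in> ell0 \<Longrightarrow> norm (APPLY s B x - B x) \<le> s"
  and APPLY_ell0: "bounded_linear B \<Longrightarrow> 0 < s \<Longrightarrow> x \<in> ell0 \<Longrightarrow> APPLY s B x \<in> ell0"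
  using routines(2) by (auto simp: apply_routine_def le_less)

lemma COARSE_error: "0 \<le> s \<Longrightarrow> s = 0 \<or> x \<in> ell0 \<Longrightarrow> norm (COARSE s x - x) \<le> s"
  and COARSE_ell0: "0 < s \<Longrightarrow> x \<in> ell0 \<Longrightarrow> COARSE s x \<in> ell0"
  using routines(3) by (auto simp: coarse_routine_def le_less)

lemma rate_nonneg: "0 \<le> \<rho>"
proof -
  obtain C where "\<And>x. norm (x - \<alpha> *\<^sub>R adjoint M (M x)) \<le> C * norm x"
    using richardson_bound [of \<alpha>] by blast
  then show ?thesis
    unfolding richardson_rate_def
    by (intro onorm_on_nonneg subspace_0 subspace_range)
qed

lemma rate_bound: "x \<in> range M \<Longrightarrow> norm (x - \<alpha> *\<^sub>R adjoint M (M x)) \<le> \<rho> * norm x"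
proof -
  obtain C where "\<And>x. norm (x - \<alpha> *\<^sub>R adjoint M (M x)) \<le> C * norm x"
    using richardson_bound [of \<alpha>] by blast
  note C = this
  assume "x \<in> range M"
  then show ?thesis
    unfolding richardson_rate_def by (rule norm_le_onorm_on [OF _ C])
qed

text \<open>If \<open>\<rho>\<close> were at least \<open>1\<close>, so would be its powers, and
  \<open>3 * \<rho> ^ K\<close> would exceed \<open>\<theta>\<close>.\<close>

lemma rate_less_1: "\<rho> < 1"
  using K \<theta> one_le_power [of \<rho> K] by linarith

lemma K_pos: "0 < K"
  using K \<theta> by (cases K) auto

text \<open>
  For \<open>e > 0\<close> the condition \<open>0 < N\<close> excludes the junk value \<open>s = 0\<close>. For \<open>e = 0\<close> all
  routines are exact, so that finite support is not needed.
\<close>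

lemma richardson_step:
  assumes f: "f \<in> range M" and e: "0 \<le> e" "e = 0 \<or> 0 < N" and y: "e = 0 \<or> y \<in> ell0"
  defines "t \<equiv> \<theta> * e / (12 * \<alpha> * real K)"
    and "s \<equiv> \<theta> * e / (12 * \<alpha> * real K * N)"
  defines "y' \<equiv> y - \<alpha> *\<^sub>R (APPLY t (adjoint M) (APPLY s M y) - APPLY t (adjoint M) (RHS s f))"
  shows "e = 0 \<or> y' \<in> ell0"
    and "norm (P y' - G f) \<le> \<rho> * norm (P y - G f) + \<theta> * e / (3 * real K)"
proof -
  have st: "0 \<le> s" "0 \<le> t" "N * s \<le> t"
    using e \<alpha> \<theta> K_pos by (auto simp: s_def t_def)
  have st_pos: "0 < s" "0 < t" if "e \<noteq> 0"
    using that e \<alpha> \<theta> K_pos by (auto simp: s_def t_def)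
  have st_0: "s = 0" "t = 0" if "e = 0"
    using that by (auto simp: s_def t_def)
  let ?w = "APPLY s M y" and ?g = "RHS s f"
  have in_ell0: "e = 0 \<or> ?w \<in> ell0" "e = 0 \<or> ?g \<in> ell0"
    using y st_pos by (auto intro: APPLY_ell0 bounded_linear RHS_ell0)
  then show "e = 0 \<or> y' \<in> ell0"
    using y st_pos unfolding y'_def
    by (auto intro!: ell0_diff ell0_scaleR APPLY_ell0 adj_linear)
  \<comment> \<open>An input that is off by \<open>s\<close> costs at most
    \<open>N * s \<le> t\<close> under \<open>adjoint M\<close>; the routine itself adds another
    \<open>t\<close>.\<close>
  have adj_error: "norm (APPLY t (adjoint M) x - adjoint M z) \<le> 2 * t"
    if "norm (x - z) \<le> s" "e = 0 \<or> x \<in> ell0" for x z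
  proof -
    have "APPLY t (adjoint M) x - adjoint M z
        = (APPLY t (adjoint M) x - adjoint M x) + adjoint M (x - z)"
      by (simp add: adj.diff)
    then have "norm (APPLY t (adjoint M) x - adjoint M z)
        \<le> norm (APPLY t (adjoint M) x - adjoint M x) + norm (adjoint M (x - z))"
      by (metis norm_triangle_ineq)
    also have "norm (APPLY t (adjoint M) x - adjoint M x) \<le> t"
      using that(2) st st_0 by (intro APPLY_error adj_linear) auto
    also have "norm (adjoint M (x - z)) \<le> N * s"
      using norm_adjoint [of "x - z"] mult_left_mono [OF that(1) onorm_pos_le [OF adj_linear]]
      by linarith
    finally show ?thesis
      using st(3) by linarith
  qed
  define p where "p = APPLY t (adjoint M) ?w - adjoint M (M y)"
  define q where "q = APPLY t (adjoint M) ?g - adjoint M f"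
  have p: "norm p \<le> 2 * t"
    unfolding p_def using y st st_0 in_ell0
    by (intro adj_error APPLY_error bounded_linear) auto
  have q: "norm q \<le> 2 * t"
    unfolding q_def using st in_ell0 by (intro adj_error RHS_error) auto
  \<comment> \<open>The projected error. As \<open>M x = M y - f\<close>, an exact step would send
    it to \<open>x - \<alpha> *\<^sub>R adjoint M (M x)\<close>; \<open>p\<close> and
    \<open>q\<close> collect the routine errors.\<close>
  define x where "x = P y - G f"
  have x: "x \<in> range M"
    unfolding x_def using f by (intro subspace_diff subspace_range orth_proj_in range_inv_in)
  have Mx: "M x = M y - f"
    using f by (simp add: x_def M.diff apply_orth_proj apply_range_inv)
  have "y' = (y - \<alpha> *\<^sub>R adjoint M (M x)) - \<alpha> *\<^sub>R (p - q)"
    by (simp add: y'_def p_def q_def Mx adj.diff algebra_simps)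
  then have "P y' - G f = (P y - P (\<alpha> *\<^sub>R adjoint M (M x))) - P (\<alpha> *\<^sub>R (p - q)) - G f"
    by (simp add: orth_proj_diff)
  also have "P (\<alpha> *\<^sub>R adjoint M (M x)) = \<alpha> *\<^sub>R adjoint M (M x)"
    by (intro orth_proj_id subspace_scale subspace_range adjoint_in_range)
  finally have "P y' - G f = (x - \<alpha> *\<^sub>R adjoint M (M x)) - P (\<alpha> *\<^sub>R (p - q))"
    by (simp add: x_def)
  then have "norm (P y' - G f)
      \<le> norm (x - \<alpha> *\<^sub>R adjoint M (M x)) + norm (P (\<alpha> *\<^sub>R (p - q)))"
    by (simp add: norm_triangle_ineq4)
  also have "norm (x - \<alpha> *\<^sub>R adjoint M (M x)) \<le> \<rho> * norm x"
    by (rule rate_bound [OF x])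
  also have "norm (P (\<alpha> *\<^sub>R (p - q))) \<le> \<alpha> * (4 * t)"
  proof (rule order_trans [OF norm_orth_proj])
    have "norm (p - q) \<le> 4 * t"
      using p q norm_triangle_ineq4 [of p q] by linarith
    then show "norm (\<alpha> *\<^sub>R (p - q)) \<le> \<alpha> * (4 * t)"
      using \<alpha> by simp
  qed
  \<comment> \<open>The factor \<open>12\<close> in the tolerances is chosen so that
    \<open>K\<close> steps with four errors of size \<open>t\<close> consume one third of
    \<open>\<theta> * e\<close>.\<close>
  also have "\<alpha> * (4 * t) = \<theta> * e / (3 * real K)"
    using \<alpha> by (simp add: t_def)
  finally show "norm (P y' - G f) \<le> \<rho> * norm (P y - G f) + \<theta> * e / (3 * real K)"
    by (simp add: x_def)
qed

text \<open>A vanishing adjoint forces \<open>M x \<bullet> M x = 0\<close> for all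
  \<open>x\<close>, so that the range contains only \<open>0\<close>.\<close>

lemma adjoint_pos: "f \<in> range M \<Longrightarrow> f \<noteq> 0 \<Longrightarrow> 0 < N"
proof (rule ccontr)
  assume f: "f \<in> range M" "f \<noteq> 0" and "\<not> 0 < N"
  then have "N = 0"
    using onorm_pos_le [OF adj_linear] by simp
  then have "adjoint M y = 0" for y
    using norm_adjoint [of y] by simp
  then have "M x \<bullet> M x = 0" for x
    by (simp add: adjoint_bounded_linear(1) [OF bounded_linear])
  with f show False
    by auto
qed

lemma solve_tolerance: "fst (solve_st f j) = (3 * \<rho> ^ K / \<theta>) ^ j * (range_inv_norm M * norm f)"
  by (induction j) (simp_all add: Let_def split_def)

lemma solve_tolerance_nonneg: "0 \<le> fst (solve_st f j)"
  unfolding solve_tolerance using rate_nonneg \<theta> onorm_range_inv_nonneg by simp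

text \<open>The loop invariant. The new tolerance \<open>e\<close> is shared out: contraction leaves
  \<open>\<rho> ^ K * e0 = \<theta> * e / 3\<close>, the perturbations add at most
  \<open>\<theta> * e / 3\<close>, and coarsening at most \<open>(1 - \<theta>) * e\<close>.\<close>

lemma solve_state_error:
  assumes f: "f \<in> range M"
  shows "norm (P (snd (solve_st f j)) - G f) \<le> fst (solve_st f j)
      \<and> (fst (solve_st f j) = 0 \<or> snd (solve_st f j) \<in> ell0)"
proof (induction j)
  case 0
  then show ?case
    using norm_range_inv [OF f] by (simp add: orth_proj_0)
next
  case (Suc j)
  obtain e0 v where st: "solve_st f j = (e0, v)"
    by fastforce
  define e where "e = 3 * \<rho> ^ K * e0 / \<theta>"
  define t where "t = \<theta> * e / (12 * \<alpha> * real K)"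
  define s where "s = \<theta> * e / (12 * \<alpha> * real K * N)"
  define step where "step = (\<lambda>y. y - \<alpha> *\<^sub>R
    (APPLY t (adjoint M) (APPLY s M y) - APPLY t (adjoint M) (RHS s f)))"
  define w where "w = (step ^^ K) v"
  define \<delta> where "\<delta> = \<theta> * e / (3 * real K)"
  have st': "solve_st f (Suc j) = (e, COARSE ((1 - \<theta>) * e) w)"
    by (simp add: st Let_def w_def step_def s_def t_def e_def)
  have e_nonneg: "0 \<le> e"
    using solve_tolerance_nonneg [of f "Suc j"] st' by simp
  have v: "norm (P v - G f) \<le> e0" "e = 0 \<or> v \<in> ell0"
    using Suc st by (auto simp: e_def)
  \<comment> \<open>\<open>e\<close> is a multiple of \<open>norm f\<close>, so
    \<open>e \<noteq> 0\<close> implies \<open>f \<noteq> 0\<close>.\<close>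
  have N: "e = 0 \<or> 0 < N"
    using solve_tolerance [of f "Suc j"] st' adjoint_pos [OF f] by force
  have step: "(e = 0 \<or> (step ^^ k) v \<in> ell0) \<and>
      norm (P ((step ^^ k) v) - G f) \<le> \<rho> ^ k * e0 + real k * \<delta>" for k
  proof (induction k)
    case 0
    then show ?case
      using v by simp
  next
    case (Suc k)
    let ?y = "(step ^^ k) v"
    have *: "e = 0 \<or> ?y \<in> ell0"
      using Suc by blast
    have "norm (P (step ?y) - G f) \<le> \<rho> * norm (P ?y - G f) + \<delta>"
      unfolding \<delta>_def step_def s_def t_def
      by (rule richardson_step(2) [OF f e_nonneg N *, unfolded step_def s_def t_def])
    also have "\<dots> \<le> \<rho> * (\<rho> ^ k * e0 + real k * \<delta>) + \<delta>"
      using Suc rate_nonneg by (intro add_right_mono mult_left_mono) auto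
    also have "\<dots> = \<rho> ^ Suc k * e0 + \<rho> * (real k * \<delta>) + \<delta>"
      by (simp add: distrib_left mult.assoc)
    \<comment> \<open>Earlier perturbations do not grow, so they accumulate at most
      linearly.\<close>
    also have "\<rho> * (real k * \<delta>) \<le> real k * \<delta>"
      using rate_nonneg rate_less_1 e_nonneg \<theta> by (intro mult_left_le_one_le) (auto simp: \<delta>_def)
    finally have "norm (P (step ?y) - G f) \<le> \<rho> ^ Suc k * e0 + real (Suc k) * \<delta>"
      by (simp add: distrib_right)
    moreover have "e = 0 \<or> step ?y \<in> ell0"
      using richardson_step(1) [OF f e_nonneg N *] unfolding step_def s_def t_def .
    ultimately show ?case
      by simp
  qed
  have w: "e = 0 \<or> w \<in> ell0" "norm (P w - G f) \<le> \<rho> ^ K * e0 + real K * \<delta>"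
    using step [of K] by (auto simp: w_def)
  let ?c = "COARSE ((1 - \<theta>) * e) w"
  have "P ?c - G f = P (?c - w) + (P w - G f)"
    by (simp add: orth_proj_diff)
  then have "norm (P ?c - G f) \<le> norm (P (?c - w)) + norm (P w - G f)"
    by (metis norm_triangle_ineq)
  also have "norm (P (?c - w)) \<le> (1 - \<theta>) * e"
    using w(1) \<theta> e_nonneg by (intro order_trans [OF norm_orth_proj] COARSE_error) auto
  also have "norm (P w - G f) \<le> \<theta> * e / 3 + \<theta> * e / 3"
    using w(2) \<theta> K_pos by (simp add: e_def \<delta>_def)
  finally have "norm (P ?c - G f) \<le> e - \<theta> * e / 3"
    by (simp add: algebra_simps)
  also have "\<dots> \<le> e"
    using \<theta> e_nonneg by simp
  finally have "norm (P ?c - G f) \<le> e" .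
  moreover have "e = 0 \<or> ?c \<in> ell0"
    using w(1) \<theta> e_nonneg by (auto intro: COARSE_ell0)
  ultimately show ?case
    by (simp only: st' fst_conv snd_conv)
qed

text \<open>The tolerances decay with ratio \<open>3 * \<rho> ^ K / \<theta> < 1\<close>, so the
  \<open>LEAST\<close> in \<open>solve\<close> is attained; the invariant applies at that
  index.\<close>

lemma solve_error:
  assumes "0 < \<epsilon>" "f \<in> range M"
  shows "norm (P (solve RHS APPLY COARSE \<alpha> \<theta> K \<epsilon> M f) - G f) \<le> \<epsilon>"
proof -
  have "(\<lambda>j. (3 * \<rho> ^ K / \<theta>) ^ j * (range_inv_norm M * norm f)) \<longlonglongrightarrow> 0"
    using K \<theta> rate_nonneg
    by (intro tendsto_mult_left_zero LIMSEQ_power_zero) (simp add: field_simps)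
  then have "\<forall>\<^sub>F j in sequentially. fst (solve_st f j) < \<epsilon>"
    unfolding solve_tolerance using assms(1) by (rule order_tendstoD)
  then obtain j where "fst (solve_st f j) \<le> \<epsilon>"
    unfolding eventually_sequentially using less_imp_le by blast
  then have "fst (solve_st f (LEAST j. fst (solve_st f j) \<le> \<epsilon>)) \<le> \<epsilon>"
    by (rule LeastI)
  then show ?thesis
    unfolding solve_def Let_def using solve_state_error [OF assms(2)] order_trans by blast
qed

end

section \<open>The procedure FIXPT\<close>

definition fixpt_bound :: "real \<Rightarrow> real \<Rightarrow> nat \<Rightarrow> real" where
  "fixpt_bound e0 L n = e0 * (e0 ^ n * (e0 - L * (L / e0) ^ n) / (e0 - L))"

locale fixpt_parameters =
  fixes e0 L r :: real
  assumes e0: "0 < e0" "e0 < 1" and L: "0 \<le> L" "L < 1" and e0_neq_L: "e0 \<noteq> L" and r: "0 < r"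
begin

text \<open>In this form the bound is \<open>e0\<close> times the geometric sum of
  \<open>e0 ^ k * L ^ (n - k)\<close> over \<open>k \<le> n\<close>, from which the recursion and
  the decay can be read off.\<close>

lemma fixpt_bound_eq: "fixpt_bound e0 L n = e0 * (e0 ^ Suc n - L ^ Suc n) / (e0 - L)"
proof -
  have "e0 ^ n * (e0 - L * (L / e0) ^ n) = e0 ^ Suc n - L ^ Suc n"
    using e0 by (simp add: power_divide right_diff_distrib mult_ac)
  then show ?thesis
    by (simp add: fixpt_bound_def)
qed

lemma fixpt_bound_0: "fixpt_bound e0 L 0 = e0"
  using e0_neq_L by (simp add: fixpt_bound_eq)

lemma fixpt_bound_Suc: "fixpt_bound e0 L (Suc n) = e0 ^ Suc (Suc n) + L * fixpt_bound e0 L n"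
  using e0_neq_L by (simp add: fixpt_bound_eq field_simps)

text \<open>The recursion adds a nonnegative term to the power. This gives positivity of the bound
  and, later, the lower estimate of the iteration count.\<close>

lemma power_le_fixpt_bound: "e0 ^ Suc n \<le> fixpt_bound e0 L n"
proof (induction n)
  case (Suc n)
  have "0 \<le> fixpt_bound e0 L n"
    using e0 by (intro order_trans [OF _ Suc]) simp
  then show ?case
    using L by (simp only: fixpt_bound_Suc) simp
qed (simp add: fixpt_bound_0)

lemma fixpt_bound_geometric:
  obtains C q where "0 < C" "0 < q" "q < 1" "\<And>n. fixpt_bound e0 L n + L ^ n * r \<le> C * q ^ n"
proof -
  \<comment> \<open>Positive even for \<open>L = 0\<close>, so that its logarithm can be used in the
    iteration count.\<close>
  define q where "q = max e0 L"
  have q: "0 < q" "q < 1" "e0 \<le> q" "L \<le> q"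
    using e0 L by (auto simp: q_def)
  have "fixpt_bound e0 L n + L ^ n * r \<le> (1 / \<bar>e0 - L\<bar> + r) * q ^ n" for n
  proof -
    have "\<bar>e0 ^ Suc n - L ^ Suc n\<bar> \<le> q ^ Suc n"
      using power_mono [of e0 q "Suc n"] power_mono [of L q "Suc n"] q e0 L
        zero_le_power [of e0 "Suc n"] zero_le_power [of L "Suc n"]
      unfolding abs_le_iff by linarith
    also have "\<dots> \<le> q ^ n"
      using q by (simp add: mult_left_le_one_le)
    finally have "e0 * \<bar>e0 ^ Suc n - L ^ Suc n\<bar> \<le> 1 * q ^ n"
      using e0 by (intro mult_mono) auto
    then have "\<bar>fixpt_bound e0 L n\<bar> \<le> 1 / \<bar>e0 - L\<bar> * q ^ n"
      using e0 by (simp add: fixpt_bound_eq abs_mult divide_right_mono del: power_Suc)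
    moreover have "L ^ n * r \<le> r * q ^ n"
      using power_mono [of L q n] q L r by simp
    ultimately show ?thesis
      by (simp add: distrib_right)
  qed
  moreover have "0 < 1 / \<bar>e0 - L\<bar> + r"
    using r by (simp add: add_nonneg_pos)
  ultimately show thesis
    using that q by blast
qed

lemma fixpt_bound_tendsto: "(\<lambda>n. fixpt_bound e0 L n + L ^ n * r) \<longlonglongrightarrow> 0"
proof -
  obtain C q where C: "0 < q" "q < 1" "\<And>n. fixpt_bound e0 L n + L ^ n * r \<le> C * q ^ n"
    by (rule fixpt_bound_geometric) blast
  show ?thesis
  proof (rule tendsto_sandwich [OF _ _ tendsto_const])
    show "\<forall>\<^sub>F n in sequentially. 0 \<le> fixpt_bound e0 L n + L ^ n * r"
      using e0 L r by (intro always_eventually allI add_nonneg_nonneg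
        order_trans [OF _ power_le_fixpt_bound]) auto
    show "(\<lambda>n. C * q ^ n) \<longlonglongrightarrow> 0"
      using C by (intro tendsto_mult_right_zero LIMSEQ_power_zero) simp
  qed (use C in simp)
qed

text \<open>The threshold in the loop test is \<open>(\<epsilon> - L ^ i * r) / X\<close> with
  \<open>X > 0\<close>, and \<open>e0 ^ i * X\<close> is the error bound. Index \<open>0\<close> is
  set apart because \<open>fixpt_tol e0 0\<close> is \<open>e0\<close>, not
  \<open>e0 ^ 0\<close>.\<close>

lemma fixpt_continues_iff:
  assumes "0 < i"
  shows "fixpt_continues e0 L r \<epsilon> i \<longleftrightarrow> \<epsilon> < fixpt_bound e0 L i + L ^ i * r"
proof -
  define X where "X = e0 * (e0 - L * (L / e0) ^ i) / (e0 - L)"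
  have X: "fixpt_bound e0 L i = e0 ^ i * X"
    by (simp add: fixpt_bound_def X_def)
  have "0 < fixpt_bound e0 L i"
    using e0 by (intro less_le_trans [OF _ power_le_fixpt_bound]) simp
  then have "0 < X"
    using e0 by (simp add: X zero_less_mult_iff)
  have "(e0 - L) / (e0 * (e0 - L * (L / e0) ^ i)) = 1 / X"
    by (simp add: X_def)
  note eq = this
  show ?thesis
    unfolding fixpt_continues_def fixpt_tol_def eq X
    using assms \<open>0 < X\<close> by (simp add: field_simps)
qed

text \<open>Tolerance and factor both equal \<open>e0\<close> here, whence the square.\<close>

lemma fixpt_continues_0_iff: "fixpt_continues e0 L r \<epsilon> 0 \<longleftrightarrow> \<epsilon> < e0\<^sup>2 + r"
proof -
  have eq: "(e0 - L) / (e0 * (e0 - L * (L / e0) ^ 0)) = 1 / e0"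
    using e0_neq_L by simp
  show ?thesis
    unfolding fixpt_continues_def fixpt_tol_def eq
    using e0 by (simp add: field_simps power2_eq_square)
qed

lemma fixpt_terminates: "0 < \<epsilon> \<Longrightarrow> \<exists>i. \<not> fixpt_continues e0 L r \<epsilon> i"
proof -
  assume "0 < \<epsilon>"
  then have "\<forall>\<^sub>F n in sequentially. fixpt_bound e0 L n + L ^ n * r < \<epsilon>"
    by (rule order_tendstoD [OF fixpt_bound_tendsto])
  then have "\<forall>\<^sub>F n in sequentially. 0 < n \<and> fixpt_bound e0 L n + L ^ n * r < \<epsilon>"
    by (intro eventually_conj eventually_gt_at_top)
  then obtain n where "0 < n" "fixpt_bound e0 L n + L ^ n * r < \<epsilon>"
    by (auto simp: eventually_sequentially)
  then show ?thesis
    by (intro exI [of _ n]) (simp add: fixpt_continues_iff)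
qed

lemma not_fixpt_continues_count: "0 < \<epsilon> \<Longrightarrow> \<not> fixpt_continues e0 L r \<epsilon> (fixpt_count e0 L r \<epsilon>)"
  unfolding fixpt_count_def by (rule LeastI_ex) (rule fixpt_terminates)

lemma fixpt_count_le: "\<not> fixpt_continues e0 L r \<epsilon> i \<Longrightarrow> fixpt_count e0 L r \<epsilon> \<le> i"
  unfolding fixpt_count_def by (rule Least_le)

text \<open>Leaving the loop at index \<open>n > 0\<close> forces
  \<open>e0 ^ (n + 1) \<le> \<epsilon>\<close>; the condition \<open>\<epsilon> < r\<close> rules
  out \<open>n = 0\<close>.\<close>

lemma fixpt_count_ge_ln:
  assumes \<epsilon>: "0 < \<epsilon>" "\<epsilon> < r"
  shows "- ln \<epsilon> \<le> - 2 * ln e0 * real (fixpt_count e0 L r \<epsilon>)"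
proof -
  let ?n = "fixpt_count e0 L r \<epsilon>"
  have n: "0 < ?n"
  proof (rule gr0I)
    assume "?n = 0"
    then have "e0\<^sup>2 + r \<le> \<epsilon>"
      using not_fixpt_continues_count [OF \<epsilon>(1)] by (simp add: fixpt_continues_0_iff not_less)
    then show False
      using \<epsilon>(2) zero_le_power2 [of e0] by linarith
  qed
  then have "fixpt_bound e0 L ?n + L ^ ?n * r \<le> \<epsilon>"
    using not_fixpt_continues_count [OF \<epsilon>(1)] by (simp add: fixpt_continues_iff)
  moreover have "0 \<le> L ^ ?n * r"
    using L r by simp
  ultimately have "e0 ^ Suc ?n \<le> \<epsilon>"
    using power_le_fixpt_bound [of ?n] by linarith
  then have "ln (e0 ^ Suc ?n) \<le> ln \<epsilon>"
    using e0 \<epsilon> by (intro ln_mono) auto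
  then have "- ln \<epsilon> \<le> real (Suc ?n) * (- ln e0)"
    using e0 by (simp add: ln_realpow del: power_Suc)
  \<comment> \<open>As \<open>n\<close> is positive, \<open>n + 1 \<le> 2 * n\<close>.\<close>
  also have "\<dots> \<le> (2 * real ?n) * (- ln e0)"
    using n e0 by (intro mult_right_mono) auto
  finally show ?thesis
    by (simp add: mult_ac)
qed

text \<open>It suffices to find one index at which the geometric majorant is at most
  \<open>\<epsilon>\<close>. For \<open>\<epsilon> \<le> exp (-1)\<close> additive constants are
  absorbed, since \<open>- ln \<epsilon> \<ge> 1\<close>.\<close>

lemma fixpt_count_le_ln:
  obtains C where "\<And>\<epsilon>. 0 < \<epsilon> \<Longrightarrow> \<epsilon> \<le> exp (-1) \<Longrightarrow> real (fixpt_count e0 L r \<epsilon>) \<le> C * (- ln \<epsilon>)"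
proof -
  obtain C q where C: "0 < C" "0 < q" "q < 1"
    "\<And>n. fixpt_bound e0 L n + L ^ n * r \<le> C * q ^ n"
    by (rule fixpt_bound_geometric) blast
  define \<mu> where "\<mu> = - ln q"
  have \<mu>: "0 < \<mu>"
    using C by (simp add: \<mu>_def)
  have "real (fixpt_count e0 L r \<epsilon>) \<le> ((\<bar>ln C\<bar> + 1) / \<mu> + 2) * (- ln \<epsilon>)"
    if \<epsilon>: "0 < \<epsilon>" "\<epsilon> \<le> exp (-1)" for \<epsilon>
  proof -
    have ln_\<epsilon>: "1 \<le> - ln \<epsilon>"
      using ln_mono [OF \<epsilon>(2,1)] by simp
    \<comment> \<open>The real solution of \<open>C * q powr x = \<epsilon>\<close>. Rounding up and
      taking the successor gives a positive index, as \<open>fixpt_continues_iff\<close>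
      demands.\<close>
    define x where "x = (ln C - ln \<epsilon>) / \<mu>"
    define i where "i = Suc (nat \<lceil>x\<rceil>)"
    have x_le: "x \<le> real i"
      by (simp add: i_def) linarith
    have i_le: "real i \<le> \<bar>x\<bar> + 2"
      by (simp add: i_def) linarith
    have "ln (C * q ^ i) = ln C - \<mu> * real i"
      using C by (simp add: ln_mult ln_realpow \<mu>_def)
    also have "\<dots> \<le> ln C - \<mu> * x"
      using x_le \<mu> by simp
    also have "\<dots> = ln \<epsilon>"
      using \<mu> by (simp add: x_def)
    finally have "C * q ^ i \<le> \<epsilon>"
      using C \<epsilon> by (simp add: ln_le_cancel_iff)
    then have "\<not> fixpt_continues e0 L r \<epsilon> i"
      using C(4) [of i] by (simp add: fixpt_continues_iff i_def not_less)
    then have "real (fixpt_count e0 L r \<epsilon>) \<le> \<bar>x\<bar> + 2"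
      using fixpt_count_le i_le by fastforce
    also have "\<bar>x\<bar> \<le> (\<bar>ln C\<bar> + (- ln \<epsilon>)) / \<mu>"
      using \<mu> ln_\<epsilon> by (auto simp: x_def abs_divide intro!: divide_right_mono)
    also have "\<bar>ln C\<bar> \<le> \<bar>ln C\<bar> * (- ln \<epsilon>)"
      using mult_left_mono [OF ln_\<epsilon>, of "\<bar>ln C\<bar>"] by simp
    also have "(\<bar>ln C\<bar> * (- ln \<epsilon>) + (- ln \<epsilon>)) / \<mu> + 2
        \<le> (\<bar>ln C\<bar> * (- ln \<epsilon>) + (- ln \<epsilon>)) / \<mu> + 2 * (- ln \<epsilon>)"
      using ln_\<epsilon> by simp
    also have "\<dots> = ((\<bar>ln C\<bar> + 1) / \<mu> + 2) * (- ln \<epsilon>)"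
      by (simp add: algebra_simps add_divide_distrib diff_divide_distrib)
    finally show ?thesis
      using \<mu> by (simp add: divide_right_mono)
  qed
  then show thesis
    by (rule that)
qed

lemma fixpt_count_bigtheta:
  "(\<lambda>\<epsilon>. real (fixpt_count e0 L r \<epsilon>)) \<in> \<Theta>[at_right 0](\<lambda>\<epsilon>. - ln \<epsilon>)"
proof (rule bigthetaI)
  have small: "\<forall>\<^sub>F \<epsilon> in at_right 0. \<epsilon> \<in> {0<..<min r (exp (- 1))}"
    using r by (intro eventually_at_right_real) simp
  obtain C where "\<And>\<epsilon>. 0 < \<epsilon> \<Longrightarrow> \<epsilon> \<le> exp (-1) \<Longrightarrow> real (fixpt_count e0 L r \<epsilon>) \<le> C * (- ln \<epsilon>)"
    by (rule fixpt_count_le_ln) blast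
  note C = this
  have ln_neg: "ln \<epsilon> < 0" if "0 < \<epsilon>" "\<epsilon> < exp (-1)" for \<epsilon> :: real
    using that less_trans [OF that(2), of 1] by simp
  show "(\<lambda>\<epsilon>. real (fixpt_count e0 L r \<epsilon>)) \<in> O[at_right 0](\<lambda>\<epsilon>. - ln \<epsilon>)"
  proof (rule bigoI [of _ C])
    show "\<forall>\<^sub>F \<epsilon> in at_right 0. norm (real (fixpt_count e0 L r \<epsilon>)) \<le> C * norm (- ln \<epsilon>)"
      using small
    proof eventually_elim
      case (elim \<epsilon>)
      then show ?case
        using C [of \<epsilon>] ln_neg [of \<epsilon>] by simp
    qed
  qed
  show "(\<lambda>\<epsilon>. real (fixpt_count e0 L r \<epsilon>)) \<in> \<Omega>[at_right 0](\<lambda>\<epsilon>. - ln \<epsilon>)"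
    unfolding bigomega_iff_bigo
  proof (rule bigoI [of _ "- 2 * ln e0"])
    show "\<forall>\<^sub>F \<epsilon> in at_right 0.
        norm (- ln \<epsilon>) \<le> - 2 * ln e0 * norm (real (fixpt_count e0 L r \<epsilon>))"
      using small
    proof eventually_elim
      case (elim \<epsilon>)
      then show ?case
        using fixpt_count_ge_ln [of \<epsilon>] ln_neg [of \<epsilon>] by simp
    qed
  qed
qed

end

text \<open>
  All summands of the radius are nonnegative. The first sum stays bounded only if \<open>e0 < 1\<close>, and
  letting \<open>n \<rightarrow> \<infinity>\<close> in the last three summands gives the second bound.
\<close>

lemma fixpt_radius_bounds:
  assumes e0: "0 < e0" and L: "0 \<le> L" "L < 1" and c: "0 \<le> c"
    and radius: "\<And>n. fixpt_radius e0 L c n \<le> r"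
  shows "e0 < 1" and "2 * e0 + c + L * r \<le> r"
proof -
  let ?a = "e0 + L * (e0 + c)"
  have tol: "0 \<le> fixpt_tol e0 k" "fixpt_tol e0 0 = e0" "fixpt_tol e0 1 = e0" for k
    using e0 by (simp_all add: fixpt_tol_def)
  have le: "(\<Sum>k=2..n+1. fixpt_tol e0 k) \<le> r" "?a * (\<Sum>k<n. L ^ k) + e0 + c \<le> r" for n
  proof -
    have "0 \<le> (\<Sum>k=2..n+1. fixpt_tol e0 k)"
      by (intro sum_nonneg tol)
    moreover have
      "0 \<le> (1 + L) * (\<Sum>h | h + 3 \<le> n. \<Sum>k=3..n-h. fixpt_tol e0 k * L ^ (n - h - k))"
      "0 \<le> ?a * (\<Sum>k<n. L ^ k)"
      using tol e0 L c by (auto intro!: sum_nonneg mult_nonneg_nonneg)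
    ultimately show "(\<Sum>k=2..n+1. fixpt_tol e0 k) \<le> r" "?a * (\<Sum>k<n. L ^ k) + e0 + c \<le> r"
      using radius [of n] e0 c unfolding fixpt_radius_def Let_def tol(2,3) by linarith+
  qed
  show "e0 < 1"
  proof (rule ccontr)
    assume "\<not> e0 < 1"
    obtain n where "r < real n"
      using reals_Archimedean2 by blast
    also have "real n = (\<Sum>k=2..n+1. 1)"
      by simp
    also have "\<dots> \<le> (\<Sum>k=2..n+1. fixpt_tol e0 k)"
      using \<open>\<not> e0 < 1\<close> by (intro sum_mono) (simp add: fixpt_tol_def)
    also have "\<dots> \<le> r"
      by (rule le(1))
    finally show False
      by simp
  qed
  have "(\<lambda>n. ?a * (\<Sum>k<n. L ^ k) + e0 + c) \<longlonglongrightarrow> ?a * (1 / (1 - L)) + e0 + c"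
    using geometric_sums [of L] L unfolding sums_def by (intro tendsto_intros) auto
  then have "?a * (1 / (1 - L)) + e0 + c \<le> r"
    by (rule LIMSEQ_le_const2) (use le(2) in blast)
  \<comment> \<open>Multiplication by \<open>1 - L\<close> clears the geometric series:
    \<open>?a + (1 - L) * (e0 + c)\<close> is \<open>2 * e0 + c\<close>.\<close>
  then have "(1 - L) * (?a * (1 / (1 - L)) + e0 + c) \<le> (1 - L) * r"
    using L by (intro mult_left_mono) auto
  also have "(1 - L) * (?a * (1 / (1 - L)) + e0 + c)
      = ?a * ((1 - L) * (1 / (1 - L))) + (1 - L) * (e0 + c)"
    by algebra
  also have "(1 - L) * (1 / (1 - L)) = 1"
    using L by simp
  finally show "2 * e0 + c + L * r \<le> r"
    by (simp add: algebra_simps)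
qed

section \<open>Convergence of the FIXPT iterates\<close>

locale fixpt_procedure = solve_procedure M \<kappa> RHS COARSE APPLY \<alpha> \<theta> K
  for M :: "'n ell2 \<Rightarrow> 'n ell2" and \<kappa> RHS COARSE APPLY \<alpha> \<theta> K +
  fixes M1 :: "'n ell2 \<Rightarrow> 'n ell2" and lvec :: "'n ell2" and b e0 L r :: real
  assumes lvec: "lvec \<in> range M"
    and M1: "M1 x \<in> range M" "M1 0 = 0" "M1 (P x) = M1 x"
    and b: "0 \<le> b" "norm (M1 x - M1 y) \<le> b * (norm x + norm y) * norm (x - y)"
    and r: "0 < r" and L_eq: "L = 2 * r * (range_inv_norm M * b)" and L_less_1: "L < 1"
    and e0: "0 < e0" "e0 \<noteq> L"
    and radius: "\<And>n. fixpt_radius e0 L (range_inv_norm M * norm lvec) n \<le> r"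
begin

abbreviation "H \<equiv> fixpt_map M M1 lvec"
abbreviation "v \<equiv> fixpt_iter (solve RHS APPLY COARSE \<alpha> \<theta> K) e0 M M1 lvec"

lemma L_nonneg: "0 \<le> L"
  using L_eq r b onorm_range_inv_nonneg by simp

lemma inv_lvec_nonneg: "0 \<le> range_inv_norm M * norm lvec"
  using onorm_range_inv_nonneg by simp

lemmas radius_bounds = fixpt_radius_bounds [OF e0(1) L_nonneg L_less_1 inv_lvec_nonneg radius]

sublocale fixpt_parameters e0 L r
  by unfold_locales (use e0 radius_bounds(1) L_nonneg L_less_1 r in auto)

lemma residual_in_range: "lvec - M1 x \<in> range M"
  by (intro subspace_diff subspace_range lvec M1)

lemma H_in_range: "H x \<in> range M"
  unfolding fixpt_map_def by (intro range_inv_in residual_in_range)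

text \<open>On the ball \<open>norm x + norm y \<le> 2 * r\<close>, which turns the quadratic
  estimate for \<open>M1\<close> into the factor \<open>L\<close>.\<close>

lemma H_lipschitz:
  assumes "norm x \<le> r" "norm y \<le> r"
  shows "norm (H x - H y) \<le> L * norm (x - y)"
proof -
  have diff: "M1 y - M1 x \<in> range M"
    by (intro subspace_diff subspace_range M1)
  have "H x - H y = G ((lvec - M1 x) - (lvec - M1 y))"
    unfolding fixpt_map_def by (rule range_inv_diff [symmetric]; rule residual_in_range)
  then have "norm (H x - H y) \<le> range_inv_norm M * norm (M1 y - M1 x)"
    using norm_range_inv [OF diff] by simp
  also have "\<dots> \<le> range_inv_norm M * (b * (r + r) * norm (x - y))"
  proof (intro mult_left_mono onorm_range_inv_nonneg)
    have "norm (M1 y - M1 x) \<le> b * (norm y + norm x) * norm (y - x)"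
      by (rule b)
    also have "\<dots> \<le> b * (r + r) * norm (y - x)"
      using assms b by (intro mult_right_mono mult_left_mono add_mono) auto
    finally show "norm (M1 y - M1 x) \<le> b * (r + r) * norm (x - y)"
      by (simp add: norm_minus_commute)
  qed
  finally show ?thesis
    by (simp add: L_eq mult_ac)
qed

lemma norm_H:
  assumes "norm x \<le> r"
  shows "norm (H x) \<le> range_inv_norm M * norm lvec + L * r"
proof -
  have "norm (H x) \<le> norm (H 0) + norm (H x - H 0)"
    using norm_triangle_sub by blast
  also have "norm (H 0) \<le> range_inv_norm M * norm lvec"
    using norm_range_inv [OF lvec] by (simp add: fixpt_map_def M1)
  also have "norm (H x - H 0) \<le> L * norm x"
    using H_lipschitz [of x 0] assms r by simp
  also have "\<dots> \<le> L * r"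
    by (intro mult_left_mono assms L_nonneg)
  finally show ?thesis
    by simp
qed

text \<open>Banach's theorem applies: the ball is closed in a complete space, and
  \<open>norm_H\<close> with \<open>radius_bounds(2)\<close> keeps \<open>H\<close> inside
  it.\<close>

lemma H_fixed_point: "\<exists>!u. u \<in> range_ball M r \<and> H u = u"
proof -
  have "\<exists>!u\<in>range_ball M r. H u = u"
  proof (rule Banach_fix)
    have "range_ball M r = range M \<inter> cball 0 r"
      by (auto simp: range_ball_def)
    then show "complete (range_ball M r)"
      using closed_range by (simp add: complete_eq_closed closed_Int)
    have "0 \<in> range_ball M r"
      using subspace_0 [OF subspace_range] r by (simp add: range_ball_def del: image_iff)
    then show "range_ball M r \<noteq> {}"
      by blast
    show "H ` range_ball M r \<subseteq> range_ball M r"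
      using H_in_range norm_H radius_bounds(2) e0 by (force simp: range_ball_def)
    show "dist (H x) (H y) \<le> L * dist x y" if "x \<in> range_ball M r" "y \<in> range_ball M r" for x y
      using that H_lipschitz by (simp add: range_ball_def dist_norm)
  qed (use L L_nonneg in auto)
  then show ?thesis
    by blast
qed

text \<open>SOLVE receives the residual of the unprojected \<open>v n\<close>, but \<open>M1\<close>
  sees only \<open>P (v n)\<close>, so the exact solution is \<open>H (P (v n))\<close>.\<close>

lemma iterate_step: "norm (P (v (Suc n)) - H (P (v n))) \<le> e0 ^ Suc n"
  using solve_error [OF _ residual_in_range, of "e0 ^ Suc n" "v n"] e0
  by (simp add: fixpt_tol_def fixpt_map_def M1 del: power_Suc)

text \<open>Needed because \<open>H_lipschitz\<close> is confined to the ball.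
  \<open>radius_bounds(2)\<close> leaves room for the solver error, which is at most
  \<open>e0\<close>.\<close>

lemma norm_iterate: "norm (P (v n)) \<le> r"
proof (induction n)
  case 0
  then show ?case
    using r by (simp add: orth_proj_0)
next
  case (Suc n)
  have "norm (P (v (Suc n))) \<le> norm (H (P (v n))) + norm (P (v (Suc n)) - H (P (v n)))"
    by (rule norm_triangle_sub)
  also have "\<dots> \<le> (range_inv_norm M * norm lvec + L * r) + e0 ^ Suc n"
    by (intro add_mono norm_H Suc iterate_step)
  also have "e0 ^ Suc n \<le> e0"
    using e0 power_le_one [of e0 n]
    by (simp add: mult_le_cancel_left1)
  finally show ?case
    using radius_bounds(2) e0 by linarith
qed

context
  fixes u assumes u: "u \<in> range_ball M r" "H u = u"
begin

lemma iterate_error_step: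
  "norm (P (v (Suc n)) - u) \<le> e0 ^ Suc n + L * norm (P (v n) - u)"
proof -
  have "norm (P (v (Suc n)) - u)
      \<le> norm (P (v (Suc n)) - H (P (v n))) + norm (H (P (v n)) - H u)"
    using u(2) norm_triangle_ineq [of "P (v (Suc n)) - H (P (v n))" "H (P (v n)) - H u"] by simp
  also have "\<dots> \<le> e0 ^ Suc n + L * norm (P (v n) - u)"
    using u norm_iterate by (intro add_mono iterate_step H_lipschitz) (auto simp: range_ball_def)
  finally show ?thesis .
qed

text \<open>The start at \<open>0\<close> contributes the initial error \<open>norm u\<close>. The
  exponent \<open>Suc n\<close>, one better than in the stated estimate, serves the exit at index
  \<open>0\<close> in \<open>final_error\<close>.\<close>

lemma iterate_error_Suc: "norm (P (v (Suc n)) - u) \<le> fixpt_bound e0 L n + L ^ Suc n * norm u"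
proof (induction n)
  case 0
  then show ?case
    using iterate_error_step [of 0] by (simp add: orth_proj_0 fixpt_bound_0)
next
  case (Suc n)
  have "norm (P (v (Suc (Suc n))) - u) \<le> e0 ^ Suc (Suc n) + L * norm (P (v (Suc n)) - u)"
    by (rule iterate_error_step)
  also have "\<dots> \<le> e0 ^ Suc (Suc n) + L * (fixpt_bound e0 L n + L ^ Suc n * norm u)"
    by (intro add_left_mono mult_left_mono Suc L_nonneg)
  finally show ?case
    by (simp only: fixpt_bound_Suc) (simp add: algebra_simps)
qed

lemma norm_fixed_point: "norm u \<le> r"
  using u by (simp add: range_ball_def)

lemma iterate_error:
  "norm (P (v (Suc n)) - u) \<le> fixpt_bound e0 L n + L ^ n * norm u"
  "fixpt_bound e0 L n + L ^ n * norm u \<le> fixpt_bound e0 L n + L ^ n * r"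
proof -
  have "L ^ Suc n * norm u \<le> L ^ n * norm u"
    using L L_nonneg by (intro mult_right_mono power_decreasing) auto
  then show "norm (P (v (Suc n)) - u) \<le> fixpt_bound e0 L n + L ^ n * norm u"
    using iterate_error_Suc [of n] by linarith
  show "fixpt_bound e0 L n + L ^ n * norm u \<le> fixpt_bound e0 L n + L ^ n * r"
    using norm_fixed_point L_nonneg by (intro add_left_mono mult_left_mono) auto
qed

lemma iterates_tendsto: "(\<lambda>n. P (v n)) \<longlonglongrightarrow> u"
proof -
  have "(\<lambda>n. P (v (Suc n)) - u) \<longlonglongrightarrow> 0"
    by (intro Lim_null_comparison [OF _ fixpt_bound_tendsto] always_eventually allI
        order_trans [OF iterate_error])
  then have "(\<lambda>n. P (v (Suc n))) \<longlonglongrightarrow> u"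
    by (rule LIM_zero_cancel)
  then show ?thesis
    by (rule LIMSEQ_imp_Suc)
qed

text \<open>
  At index \<open>0\<close> the stopping test reads \<open>e0\<^sup>2 + r \<le> \<epsilon>\<close>, which does not imply
  \<open>fixpt_bound e0 L 0 + r = e0 + r \<le> \<epsilon>\<close>. That case uses the radius condition instead.
\<close>

lemma final_error:
  assumes \<epsilon>: "0 < \<epsilon>"
  shows "norm (P (v (Suc (fixpt_count e0 L r \<epsilon>))) - u) \<le> \<epsilon>"
proof (cases "fixpt_count e0 L r \<epsilon> = 0")
  case True
  have "norm (P (v (Suc 0)) - u) \<le> e0 + L * norm u"
    using iterate_error_Suc [of 0] by (simp add: fixpt_bound_0)
  also have "\<dots> \<le> e0 + L * r"
    by (intro add_left_mono mult_left_mono norm_fixed_point L_nonneg)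
  also have "\<dots> \<le> r"
    using radius_bounds(2) inv_lvec_nonneg e0 by linarith
  also have "e0\<^sup>2 + r \<le> \<epsilon>"
    using not_fixpt_continues_count [OF \<epsilon>] True by (simp add: fixpt_continues_0_iff not_less)
  then have "r \<le> \<epsilon>"
    using zero_le_power2 [of e0] by linarith
  finally show ?thesis
    by (simp only: True)
next
  case False
  then have "fixpt_bound e0 L (fixpt_count e0 L r \<epsilon>) + L ^ fixpt_count e0 L r \<epsilon> * r \<le> \<epsilon>"
    using not_fixpt_continues_count [OF \<epsilon>] by (simp add: fixpt_continues_iff)
  then show ?thesis
    by (rule order_trans [OF order_trans [OF iterate_error]])
qed

end

end

section \<open>The frame discretization\<close>

locale gelfand_discretization =
  fixes J :: "'v::{real_inner,complete_space} \<Rightarrow>\<^sub>L 'h::{real_inner,complete_space}"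
    and Jd :: "'d::{real_inner,complete_space} \<Rightarrow>\<^sub>L 'n ell2"
    and f f' :: "'n \<Rightarrow> 'h"
    and Fs :: "'d \<Rightarrow>\<^sub>L 'v" and Ft :: "'v \<Rightarrow>\<^sub>L 'd"
    and D :: "'d \<Rightarrow>\<^sub>L 'n ell2"
  assumes frame: "gelfand_frame J Jd f f' Fs Ft" and unitary: "unitary_iso D"
begin

abbreviation "S \<equiv> from_coeff D Fs"
abbreviation "T \<equiv> to_coeff D Fs"
abbreviation "F_norm \<equiv> onorm (analysis Fs)"

lemma D_inv: "D (inv D x) = x" "inv D (D c) = c"
  using unitary by (simp_all add: unitary_iso_def bij_def surj_f_inv_f)

lemma D_inner: "D c \<bullet> D d = c \<bullet> d"
  using unitary by (simp add: unitary_iso_def)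

lemma norm_D: "norm (D c) = norm c"
  by (simp add: norm_eq_sqrt_inner D_inner)

lemma norm_D_inv: "norm (inv D x) = norm x"
  using norm_D [of "inv D x"] by (simp add: D_inv)

lemma bounded_linear_D_inv: "bounded_linear (inv D)"
proof (rule bounded_linear_intro)
  show "inv D (x + y) = inv D x + inv D y" for x y
    using D_inv(2) [of "inv D x + inv D y"] by (simp add: blinfun.add_right D_inv(1))
  show "inv D (a *\<^sub>R x) = a *\<^sub>R inv D x" for a x
    using D_inv(2) [of "a *\<^sub>R inv D x"] by (simp add: blinfun.scaleR_right D_inv(1))
  show "norm (inv D x) \<le> norm x * 1" for x
    by (simp add: norm_D_inv)
qed

lemma bounded_linear_analysis: "bounded_linear (analysis Fs)"
  using bounded_bilinear.bounded_linear_left [OF bounded_bilinear_blinfun_compose]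
  by (simp add: analysis_def [abs_def])

lemma norm_analysis: "norm (analysis Fs \<phi>) \<le> F_norm * norm \<phi>"
  by (rule onorm [OF bounded_linear_analysis])

lemma F_norm_nonneg: "0 \<le> F_norm"
  by (rule onorm_pos_le [OF bounded_linear_analysis])

text \<open>Duality: \<open>\<parallel>F\<^sup>*\<parallel> \<le> \<parallel>F\<parallel>\<close>, tested with the functional \<open>\<langle>F\<^sup>* c, \<cdot>\<rangle>\<close>.\<close>

lemma norm_synthesis: "norm (Fs c) \<le> F_norm * norm c"
proof (cases "Fs c = 0")
  case False
  let ?\<phi> = "blinfun_inner_right (Fs c)"
  have "norm ?\<phi> \<le> norm (Fs c)"
    by (intro norm_blinfun_bound) (simp_all add: Cauchy_Schwarz_ineq2)
  have "norm (Fs c) * norm (Fs c) = norm (analysis Fs ?\<phi> c)"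
    by (simp add: analysis_def dot_square_norm power2_eq_square)
  also have "\<dots> \<le> norm (analysis Fs ?\<phi>) * norm c"
    by (rule norm_blinfun)
  also have "\<dots> \<le> F_norm * norm (Fs c) * norm c"
    using norm_analysis [of ?\<phi>] mult_left_mono [OF \<open>norm ?\<phi> \<le> norm (Fs c)\<close> F_norm_nonneg]
    by (intro mult_right_mono) auto
  finally show ?thesis
    using False by (simp add: mult_ac)
qed (use F_norm_nonneg in simp)

lemma norm_from_coeff: "norm (S x) \<le> F_norm * norm x"
  using norm_synthesis [of "inv D x"] by (simp add: from_coeff_def norm_D_inv)

lemma bounded_linear_from_coeff: "bounded_linear S"
  unfolding from_coeff_def [abs_def]
  by (intro bounded_linear_compose [OF blinfun.bounded_linear_right] bounded_linear_D_inv)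

sublocale S: bounded_linear S
  by (rule bounded_linear_from_coeff)

text \<open>This identifies \<open>T\<close> as the dual map of \<open>S\<close>; the later facts
  about \<open>T\<close> rest on it.\<close>

lemma to_coeff_inner: "T \<phi> \<bullet> x = blinfun_apply \<phi> (S x)"
proof -
  \<comment> \<open>The \<open>inv\<close> in \<open>to_coeff\<close> is meaningful only on this
    range; by Riesz representation it contains every functional.\<close>
  have "\<psi> \<in> range (hilbert_dual D)" for \<psi>
  proof -
    have "bounded_linear (\<lambda>x. \<psi> (inv D x))"
      by (intro bounded_linear_compose [OF blinfun.bounded_linear_right] bounded_linear_D_inv)
    then obtain y where y: "\<And>x. \<psi> (inv D x) = y \<bullet> x"
      using riesz_representation by blast
    have "\<psi> = hilbert_dual D y"
      using y [of "D _"] by (intro blinfun_eqI) (simp add: hilbert_dual_def D_inv)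
    then show ?thesis
      by blast
  qed
  then have "hilbert_dual D (T \<phi>) = analysis Fs \<phi>"
    unfolding to_coeff_def by (intro f_inv_into_f)
  then have "hilbert_dual D (T \<phi>) (inv D x) = analysis Fs \<phi> (inv D x)"
    by simp
  then show ?thesis
    by (simp add: hilbert_dual_def analysis_def D_inv from_coeff_def)
qed

lemma to_coeff_eqI: "(\<And>x. y \<bullet> x = blinfun_apply \<phi> (S x)) \<Longrightarrow> T \<phi> = y"
  by (metis to_coeff_inner vector_eq_ldot inner_commute)

lemma norm_to_coeff: "norm (T \<phi>) \<le> F_norm * norm \<phi>"
proof (cases "T \<phi> = 0")
  case False
  have "norm (T \<phi>) * norm (T \<phi>) = analysis Fs \<phi> (inv D (T \<phi>))"
    using to_coeff_inner [of \<phi> "T \<phi>"]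
    by (simp add: analysis_def from_coeff_def dot_square_norm power2_eq_square)
  also have "\<dots> \<le> norm (analysis Fs \<phi>) * norm (T \<phi>)"
    using norm_blinfun [of "analysis Fs \<phi>" "inv D (T \<phi>)"] by (simp add: norm_D_inv)
  finally show ?thesis
    using False norm_analysis [of \<phi>] by simp
qed (use F_norm_nonneg in simp)

lemma to_coeff_diff: "T (\<phi> - \<psi>) = T \<phi> - T \<psi>"
  by (rule to_coeff_eqI) (simp add: inner_diff_left to_coeff_inner blinfun.diff_left)

text \<open>Under \<open>J\<close>, both sides are sums of the same dual frame expansion, and
  \<open>J\<close> is injective. So \<open>D\<close> after \<open>Ft\<close> is a bounded right
  inverse of \<open>S\<close>.\<close>

lemma from_coeff_dual_analysis: "S (D (Ft w)) = w"
proof -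
  have "((\<lambda>n. (J w \<bullet> f' n) *\<^sub>R f n) has_sum J (Fs (Ft w))) UNIV"
  proof -
    have "((\<lambda>n. coord (Jd (Ft w)) n *\<^sub>R f n) has_sum J (Fs (Ft w))) UNIV"
      using frame unfolding gelfand_frame_def by blast
    moreover have "coord (Jd (Ft w)) n = J w \<bullet> f' n" for n
      using frame unfolding gelfand_frame_def by blast
    ultimately show ?thesis
      by simp
  qed
  moreover have "((\<lambda>n. (J w \<bullet> f' n) *\<^sub>R f n) has_sum J w) UNIV"
    using frame unfolding gelfand_frame_def dual_frames_def by blast
  ultimately have "J (Fs (Ft w)) = J w"
    by (rule has_sum_unique)
  moreover have "inj (blinfun_apply J)"
    using frame unfolding gelfand_frame_def gelfand_triple_def by blast
  ultimately show ?thesis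
    by (simp add: from_coeff_def D_inv inj_eq)
qed

end

section \<open>Ellipticity and the range of the discretized operator\<close>

locale gelfand_elliptic = gelfand_discretization J Jd f f' Fs Ft D
  for J :: "'v::{real_inner,complete_space} \<Rightarrow>\<^sub>L 'h::{real_inner,complete_space}"
    and Jd :: "'d::{real_inner,complete_space} \<Rightarrow>\<^sub>L 'n ell2"
    and f f' Fs Ft D +
  fixes A :: "'v \<Rightarrow>\<^sub>L ('v \<Rightarrow>\<^sub>L real)" and \<alpha> :: real
  assumes surj_A: "surj (blinfun_apply A)"
    and elliptic: "0 < \<alpha>" "\<alpha> * (norm w)\<^sup>2 \<le> A w w"
begin

abbreviation "M \<equiv> discretize_linear D Fs A"

lemma M_inner: "M x \<bullet> y = A (S x) (S y)"
  by (simp add: discretize_linear_def to_coeff_inner)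

lemma bounded_linear_M: "bounded_linear M"
proof (rule bounded_linear_intro)
  show "M (x + y) = M x + M y" for x y
    unfolding discretize_linear_def
    by (rule to_coeff_eqI)
      (simp add: inner_add_left to_coeff_inner S.add blinfun.add_right blinfun.add_left)
  show "M (a *\<^sub>R x) = a *\<^sub>R M x" for a x
    unfolding discretize_linear_def
    by (rule to_coeff_eqI)
      (simp add: to_coeff_inner S.scaleR blinfun.scaleR_right blinfun.scaleR_left)
  show "norm (M x) \<le> norm x * (F_norm * (norm A * F_norm))" for x
  proof -
    have "norm (M x) \<le> F_norm * norm (A (S x))"
      unfolding discretize_linear_def by (rule norm_to_coeff)
    also have "norm (A (S x)) \<le> norm A * (F_norm * norm x)"
      using norm_blinfun [of A "S x"] mult_left_mono [OF norm_from_coeff, of "norm A" x] by simp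
    finally have "norm (M x) \<le> F_norm * (norm A * (F_norm * norm x))"
      using F_norm_nonneg by (simp add: mult_left_mono)
    then show ?thesis
      by (simp add: mult_ac)
  qed
qed

lemma M_eq_0_iff: "M x = 0 \<longleftrightarrow> S x = 0"
proof
  assume "M x = 0"
  then have "\<alpha> * (norm (S x))\<^sup>2 \<le> 0"
    using M_inner [of x x] elliptic(2) [of "S x"] by simp
  then show "S x = 0"
    using elliptic(1) by (simp add: mult_le_0_iff)
qed (metis M_inner S.zero blinfun.zero_left blinfun.zero_right inner_eq_zero_iff)

lemma range_M: "range M = {y. \<forall>z. S z = 0 \<longrightarrow> y \<bullet> z = 0}"
proof (intro equalityI subsetI CollectI)
  fix y assume "y \<in> {y. \<forall>z. S z = 0 \<longrightarrow> y \<bullet> z = 0}"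
  then have y: "\<And>z. S z = 0 \<Longrightarrow> y \<bullet> z = 0"
    by blast
  \<comment> \<open>This is \<open>y\<close> pulled back along the right inverse of
    \<open>S\<close>. Solving \<open>A w = \<phi>\<close> gives the preimage
    \<open>D (Ft w)\<close>, because \<open>y\<close> is orthogonal to
    \<open>x - D (Ft (S x))\<close>, a kernel vector of \<open>S\<close>.\<close>
  define \<phi> where "\<phi> = blinfun_inner_right y o\<^sub>L (D o\<^sub>L Ft)"
  obtain w where w: "A w = \<phi>"
    using surj_A by (metis surjD)
  have "M (D (Ft w)) = y"
    unfolding discretize_linear_def
  proof (rule to_coeff_eqI)
    fix x
    have "y \<bullet> (x - D (Ft (S x))) = 0"
      by (intro y) (simp add: S.diff from_coeff_dual_analysis)
    then show "y \<bullet> x = A (S (D (Ft w))) (S x)"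
      by (simp add: from_coeff_dual_analysis w \<phi>_def inner_diff_right)
  qed
  then show "y \<in> range M"
    by blast
qed (auto simp: M_inner)

lemma to_coeff_in_range: "T \<phi> \<in> range M"
  by (simp add: range_M to_coeff_inner)

sublocale range_iso M "\<alpha> / ((norm Ft)\<^sup>2 + 1)"
proof (rule range_iso.intro)
  show "bounded_linear M"
    by (rule bounded_linear_M)
  have "range M = (\<Inter>z\<in>{z. S z = 0}. {y. y \<bullet> z = 0})"
    by (auto simp: range_M)
  then show "closed (range M)"
    by (simp add: closed_INT closed_Collect_eq continuous_on_inner)
  show "M x = 0 \<longleftrightarrow> (\<forall>y. x \<bullet> M y = 0)" for x
  proof
    assume "M x = 0"
    then show "\<forall>y. x \<bullet> M y = 0"
      using M_inner inner_commute M_eq_0_iff by (metis blinfun.zero_right)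
  next
    assume x: "\<forall>y. x \<bullet> M y = 0"
    \<comment> \<open>Testing with this element of the range yields
      \<open>S x \<bullet> S x = 0\<close>.\<close>
    have "T (blinfun_inner_right (S x)) \<bullet> x = 0"
      using x to_coeff_in_range inner_commute by (metis imageE)
    then show "M x = 0"
      by (simp add: to_coeff_inner M_eq_0_iff)
  qed
  show "0 < \<alpha> / ((norm Ft)\<^sup>2 + 1)"
    using elliptic(1) by (simp add: add_nonneg_pos)
  show "\<alpha> / ((norm Ft)\<^sup>2 + 1) * norm (M x) \<le> norm (M (M x))" for x
  proof -
    define p where "p = M x"
    \<comment> \<open>An element \<open>p\<close> of the range is orthogonal to the kernel of
      \<open>S\<close>. Hence \<open>norm p \<le> norm Ft * norm (S p)\<close>, and ellipticity
      bounds \<open>norm (S p)\<close> through \<open>M p \<bullet> p\<close>.\<close>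
    have "p \<bullet> (p - D (Ft (S p))) = 0"
      by (simp add: p_def M_inner S.diff from_coeff_dual_analysis)
    then have "norm p * norm p = p \<bullet> D (Ft (S p))"
      by (simp add: inner_diff_right dot_square_norm power2_eq_square)
    also have "\<dots> \<le> norm p * norm (D (Ft (S p)))"
      by (rule norm_cauchy_schwarz)
    finally have "norm p \<le> norm (Ft (S p))"
      by (cases "p = 0") (simp_all add: norm_D)
    also have "\<dots> \<le> norm Ft * norm (S p)"
      by (rule norm_blinfun)
    finally have "(norm p)\<^sup>2 \<le> (norm Ft)\<^sup>2 * (norm (S p))\<^sup>2"
      by (metis norm_ge_zero power_mono power_mult_distrib)
    then have "\<alpha> * (norm p)\<^sup>2 \<le> (norm Ft)\<^sup>2 * (\<alpha> * (norm (S p))\<^sup>2)"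
      using elliptic(1) by (simp add: mult_left_mono mult.left_commute)
    also have "\<dots> \<le> (norm Ft)\<^sup>2 * (norm (M p) * norm p)"
      using elliptic(2) [of "S p"] norm_cauchy_schwarz [of "M p" p]
      by (intro mult_left_mono) (auto simp: M_inner)
    also have "\<dots> \<le> ((norm Ft)\<^sup>2 + 1) * (norm (M p) * norm p)"
      by (intro mult_right_mono) auto
    finally have "(\<alpha> * norm p) * norm p \<le> (((norm Ft)\<^sup>2 + 1) * norm (M p)) * norm p"
      by (simp add: power2_eq_square mult_ac)
    then have "\<alpha> * norm p \<le> ((norm Ft)\<^sup>2 + 1) * norm (M p)"
      by (cases "p = 0") auto
    then show ?thesis
      unfolding p_def by (simp add: divide_le_eq add_nonneg_pos mult.commute)
  qed
qed

lemma from_coeff_orth_proj: "S (P x) = S x"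
proof -
  have "M (P x - x) = 0"
    by (simp add: M.diff apply_orth_proj)
  then show ?thesis
    by (simp add: M_eq_0_iff S.diff)
qed

text \<open>Of the three factors \<open>F_norm\<close>, one comes from \<open>T\<close> and one from
  each argument of \<open>A1\<close> through \<open>S\<close>.\<close>

lemma norm_discretize_bilinear_diff:
  fixes A1 :: "'v \<Rightarrow>\<^sub>L 'v \<Rightarrow>\<^sub>L ('v \<Rightarrow>\<^sub>L real)"
  shows "norm (discretize_bilinear D Fs A1 x - discretize_bilinear D Fs A1 y)
    \<le> F_norm ^ 3 * norm A1 * (norm x + norm y) * norm (x - y)"
proof -
  have A1_le: "norm (A1 v w) \<le> norm A1 * norm v * norm w" for v w
    using norm_blinfun [of "A1 v" w] mult_right_mono [OF norm_blinfun [of A1 v], of "norm w"]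
    by simp
  have A1_S: "norm (A1 (S v) (S w)) \<le> F_norm\<^sup>2 * norm A1 * norm v * norm w" for v w
  proof -
    have "norm (A1 (S v) (S w)) \<le> norm A1 * norm (S v) * norm (S w)"
      by (rule A1_le)
    also have "\<dots> \<le> norm A1 * (F_norm * norm v) * (F_norm * norm w)"
      using F_norm_nonneg by (intro mult_mono norm_from_coeff) auto
    finally show ?thesis
      by (simp add: power2_eq_square mult_ac)
  qed
  \<comment> \<open>Changing one argument at a time makes each term linear in
    \<open>x - y\<close>.\<close>
  have "A1 (S x) (S x) - A1 (S y) (S y) = A1 (S x) (S (x - y)) + A1 (S (x - y)) (S y)"
    by (simp add: S.diff blinfun.diff_right blinfun.diff_left)
  then have "norm (A1 (S x) (S x) - A1 (S y) (S y))
      \<le> norm (A1 (S x) (S (x - y))) + norm (A1 (S (x - y)) (S y))"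
    by (simp add: norm_triangle_ineq)
  also have "\<dots> \<le> F_norm\<^sup>2 * norm A1 * norm x * norm (x - y)
      + F_norm\<^sup>2 * norm A1 * norm (x - y) * norm y"
    by (intro add_mono A1_S)
  also have "\<dots> = F_norm\<^sup>2 * norm A1 * (norm x + norm y) * norm (x - y)"
    by (simp add: algebra_simps)
  finally have "F_norm * norm (A1 (S x) (S x) - A1 (S y) (S y))
      \<le> F_norm * (F_norm\<^sup>2 * norm A1 * (norm x + norm y) * norm (x - y))"
    by (intro mult_left_mono F_norm_nonneg)
  moreover have "norm (T (A1 (S x) (S x)) - T (A1 (S y) (S y)))
      \<le> F_norm * norm (A1 (S x) (S x) - A1 (S y) (S y))"
    using norm_to_coeff by (simp flip: to_coeff_diff)
  ultimately show ?thesis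
    by (simp add: discretize_bilinear_def power2_eq_square power3_eq_cube mult_ac)
qed

end

section \<open>From the abstract procedures to the frame discretization\<close>

theorem theorem5p4:
  fixes J :: "'v::{real_inner,complete_space} \<Rightarrow>\<^sub>L
               'h::{real_inner,complete_space,second_countable_topology}"
    and Jd :: "'d::{real_inner,complete_space} \<Rightarrow>\<^sub>L ('n::countable) ell2"
    and f f' :: "'n \<Rightarrow> 'h"
    and Fs :: "'d \<Rightarrow>\<^sub>L 'v" and Ft :: "'v \<Rightarrow>\<^sub>L 'd"
    and D :: "'d \<Rightarrow>\<^sub>L 'n ell2"
    and A :: "'v \<Rightarrow>\<^sub>L ('v \<Rightarrow>\<^sub>L real)"
    and A1 :: "'v \<Rightarrow>\<^sub>L 'v \<Rightarrow>\<^sub>L ('v \<Rightarrow>\<^sub>L real)"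
    and l :: "'v \<Rightarrow>\<^sub>L real"
    and \<alpha> \<beta> \<alpha>' \<theta> r L e0 c :: real and K :: nat
    and RHS COARSE :: "real \<Rightarrow> 'n ell2 \<Rightarrow> 'n ell2"
    and APPLY :: "real \<Rightarrow> ('n ell2 \<Rightarrow> 'n ell2) \<Rightarrow> 'n ell2 \<Rightarrow> 'n ell2"
    and M M1 P H :: "'n ell2 \<Rightarrow> 'n ell2" and lvec :: "'n ell2"
    and SOLVE :: "real \<Rightarrow> ('n ell2 \<Rightarrow> 'n ell2) \<Rightarrow> 'n ell2 \<Rightarrow> 'n ell2"
    and v :: "nat \<Rightarrow> 'n ell2"
  assumes frame: "gelfand_frame J Jd f f' Fs Ft"
    and D: "unitary_iso D"
    and A_inv: "\<exists>B. B o\<^sub>L A = id_blinfun \<and> A o\<^sub>L B = id_blinfun"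
    and A_elliptic: "0 < \<alpha>" "0 < \<beta>"
      "\<And>w. \<alpha> * (norm w)\<^sup>2 \<le> A w w \<and> A w w \<le> \<beta> * (norm w)\<^sup>2"
    \<comment> \<open>discretized objects\<close>
    and M: "M = discretize_linear D Fs A"
    and M1: "M1 = discretize_bilinear D Fs A1"
    and lvec: "lvec = to_coeff D Fs l"
    and P: "P = orth_proj (range M)"
    and H: "H = fixpt_map M M1 lvec"
    \<comment> \<open>smallness of the data and choice of \<open>r\<^sup>*\<close>; the bounds on \<open>norm lvec\<close> and \<open>r\<close> are
        multiplied out, so that a vanishing denominator imposes no restriction\<close>
    and c: "c = range_inv_norm M * onorm (analysis Fs) ^ 3 * norm A1"
    and small: "norm lvec * (4 * range_inv_norm M * c) < 1"
    and r: "0 < r" "r * (2 * c) < 1"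
    and H_contr: "H ` range_ball M r \<subseteq> range_ball M r"
      "\<exists>q<1. q-lipschitz_on (range_ball M r) H"
    and L: "L = 2 * r * c"
    \<comment> \<open>SOLVE\<close>
    and routines: "rhs_routine RHS" "apply_routine APPLY" "coarse_routine COARSE"
    and alpha': "0 < \<alpha>'" "\<alpha>' * onorm (adjoint M \<circ> M) < 2"
    and theta: "0 < \<theta>" "\<theta> < 1/3"
    and K: "3 * richardson_rate M \<alpha>' ^ K < \<theta>"
    and SOLVE: "SOLVE = solve RHS APPLY COARSE \<alpha>' \<theta> K"
    \<comment> \<open>FIXPT\<close>
    and e0: "0 < e0" "e0 < r" "e0 \<noteq> L"
    and v: "v = fixpt_iter SOLVE e0 M M1 lvec"
    and radius: "\<And>n. fixpt_radius e0 L (range_inv_norm M * norm lvec) n \<le> r"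
  shows "\<exists>u\<in>range_ball M r.
      H u = u \<and> (\<forall>w\<in>range_ball M r. H w = w \<longrightarrow> w = u) \<and>
      (\<lambda>n. P (v n)) \<longlonglongrightarrow> u \<and> u = proj_fixpt SOLVE e0 L r 0 M M1 lvec \<and>
      (\<forall>n.
        norm (P (v (n + 1)) - u)
          \<le> e0 * (e0 ^ n * (e0 - L * (L / e0) ^ n) / (e0 - L)) + L ^ n * norm u \<and>
        e0 * (e0 ^ n * (e0 - L * (L / e0) ^ n) / (e0 - L)) + L ^ n * norm u
          \<le> e0 * (e0 ^ n * (e0 - L * (L / e0) ^ n) / (e0 - L)) + L ^ n * r) \<and>
      (\<forall>\<epsilon>>0.
        (\<exists>i. \<not> fixpt_continues e0 L r \<epsilon> i) \<and>
        norm (u - proj_fixpt SOLVE e0 L r \<epsilon> M M1 lvec) \<le> \<epsilon>) \<and>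
      (\<lambda>\<epsilon>. real (fixpt_count e0 L r \<epsilon>)) \<in> \<Theta>[at_right 0](\<lambda>\<epsilon>. - ln \<epsilon>)"
proof -
  have surj_A: "surj (blinfun_apply A)"
    using A_inv by (metis blinfun_apply_blinfun_compose blinfun_apply_id_blinfun surjI)
  interpret disc: gelfand_elliptic J Jd f f' Fs Ft D A \<alpha>
    using frame D surj_A A_elliptic by unfold_locales auto
  \<comment> \<open>The lower bound on the range comes from ellipticity and \<open>norm Ft\<close>;
    the constant \<open>b\<close> of the quadratic estimate becomes
    \<open>onorm (analysis Fs) ^ 3 * norm A1\<close>.\<close>
  interpret fp: fixpt_procedure M "\<alpha> / ((norm Ft)\<^sup>2 + 1)" RHS COARSE APPLY \<alpha>' \<theta> K M1 lvec
    "onorm (analysis Fs) ^ 3 * norm A1" e0 L r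
  proof (intro fixpt_procedure.intro solve_procedure.intro)
    show "range_iso M (\<alpha> / ((norm Ft)\<^sup>2 + 1))"
      unfolding M by (rule disc.range_iso_axioms)
    show "solve_procedure_axioms M RHS COARSE APPLY \<alpha>' \<theta> K"
      by (intro solve_procedure_axioms.intro routines alpha' theta K)
    show "fixpt_procedure_axioms M M1 lvec (onorm (analysis Fs) ^ 3 * norm A1) e0 L r"
    proof
      show "lvec \<in> range M"
        unfolding lvec M by (rule disc.to_coeff_in_range)
      show "M1 x \<in> range M" for x
        unfolding M1 M discretize_bilinear_def by (rule disc.to_coeff_in_range)
      show "M1 0 = 0"
        unfolding M1 discretize_bilinear_def
        by (rule disc.to_coeff_eqI) (simp add: disc.S.zero)
      show "M1 (orth_proj (range M) x) = M1 x" for x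
        unfolding M1 M discretize_bilinear_def by (simp add: disc.from_coeff_orth_proj)
      show "0 \<le> onorm (analysis Fs) ^ 3 * norm A1"
        using disc.F_norm_nonneg by simp
      show "norm (M1 x - M1 y)
          \<le> onorm (analysis Fs) ^ 3 * norm A1 * (norm x + norm y) * norm (x - y)" for x y
        unfolding M1 by (rule disc.norm_discretize_bilinear_diff)
      show "L = 2 * r * (range_inv_norm M * (onorm (analysis Fs) ^ 3 * norm A1))"
        by (simp add: L c mult_ac)
      show "L < 1"
        using r(2) by (simp add: L mult_ac)
    qed (use r e0 radius in auto)
  qed
  obtain u where u: "u \<in> range_ball M r" "H u = u"
    and unique: "\<And>w. w \<in> range_ball M r \<Longrightarrow> H w = w \<Longrightarrow> w = u"
    using fp.H_fixed_point unfolding H by blast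
  note u_fp = u [unfolded H]
  have v_tendsto: "(\<lambda>n. P (v n)) \<longlonglongrightarrow> u"
    unfolding P v SOLVE by (rule fp.iterates_tendsto [OF u_fp])
  then have limit: "u = proj_fixpt SOLVE e0 L r 0 M M1 lvec"
    by (simp add: proj_fixpt_def P v limI)
  have error: "norm (P (v (n + 1)) - u)
        \<le> e0 * (e0 ^ n * (e0 - L * (L / e0) ^ n) / (e0 - L)) + L ^ n * norm u \<and>
      e0 * (e0 ^ n * (e0 - L * (L / e0) ^ n) / (e0 - L)) + L ^ n * norm u
        \<le> e0 * (e0 ^ n * (e0 - L * (L / e0) ^ n) / (e0 - L)) + L ^ n * r" for n
    using fp.iterate_error [OF u_fp, of n]
    unfolding P v SOLVE Suc_eq_plus1 [symmetric] fixpt_bound_def by blast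
  have stopping: "(\<exists>i. \<not> fixpt_continues e0 L r \<epsilon> i) \<and>
      norm (u - proj_fixpt SOLVE e0 L r \<epsilon> M M1 lvec) \<le> \<epsilon>" if "0 < \<epsilon>" for \<epsilon>
  proof
    show "\<exists>i. \<not> fixpt_continues e0 L r \<epsilon> i"
      by (rule fp.fixpt_terminates [OF that])
    \<comment> \<open>\<open>fixpt\<close> returns the iterate one past the exit index, which is the
      one estimated in \<open>final_error\<close>.\<close>
    show "norm (u - proj_fixpt SOLVE e0 L r \<epsilon> M M1 lvec) \<le> \<epsilon>"
      using fp.final_error [OF u_fp that] that
      unfolding proj_fixpt_def fixpt_def SOLVE Suc_eq_plus1 by (simp add: norm_minus_commute)
  qed
  show ?thesis
    using u unique v_tendsto limit error stopping fp.fixpt_count_bigtheta by blast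
qed

end
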